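(* Let $[X,\mathcal{B},m,\nu]$ be a reversible random walk space and let $\Omega\in\mathcal{B}$ be $m$-connected with $0<\nu(\Omega)<\nu(\Omega_m)<\infty$, and assume $\Omega$ satisfies a $2$-Poincaré inequality. Then $$\frac{\nu(\Omega)^2}{P_m(\Omega)}\le T_m(\Omega).$$ Moreover, if $\Omega$ is $m$-calibrable, then $$T_m(\Omega)\le\frac12\,\frac{\nu(\Omega)^2\,\nu(\Omega_m)}{P_m(\Omega)^2}.$$
   Context: A random walk $m$ on a measurable space $(X,\mathcal{B})$ ($\mathcal{B}$ countably generated) is a family $(m_x)_{x\in X}$ of probability measures on $\mathcal{B}$ such that $x\mapsto m_x(B)$ is measurable for each $B\in\mathcal{B}$. A $\sigma$-finite measure $\nu$ on $X$ is reversible if $dm_x(y)d\nu(x)=dm_y(x)d\nu(y)$ as measures on $X\times X$; then $[X,\mathcal{B},m,\nu]$ is called a reversible random walk space. For $A,B\in\mathcal{B}$, $L_m(A,B):=\int_A m_x(B)\,d\nu(x)$, and the $m$-perimeter of $E\in\mathcal{B}$ is $P_m(E):=L_m(E,X\setminus E)$. For $\Omega\in\mathcal{B}$: $\partial_m\Omega:=\{x\in X\setminus\Omega: m_x(\Omega)>0\}$ and $\Omega_m:=\Omega\cup\partial_m\Omega$. A set $\Omega\in\mathcal B$ with $\nu(\Omega)>0$ is $m$-connected if $L_m(A,B)>0$ for all measurable $A,B\subset\Omega$ of positive $\nu$-measure with $A\cup B=\Omega$. (Under the stated hypotheses $0<P_m(\Omega)<\nu(\Omega)$.) $\Omega$ satisfies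 a $2$-Poincaré inequality if there is $\lambda>0$ with $\lambda\int_\Omega|f|^2d\nu\le\int_{\Omega_m}\int_{\Omega_m}|f(y)-f(x)|^2dm_x(y)d\nu(x)$ for all $f\in L^2(\Omega_m,\nu)$ with $f=0$ $\nu$-a.e. on $\partial_m\Omega$. The $m$-stress function $f_\Omega$ is the unique solution in $L^2(\Omega_m,\nu)$ (equalities $\nu$-a.e.) of $-\int_{\Omega_m}(f_\Omega(y)-f_\Omega(x))\,dm_x(y)=1$ for $x\in\Omega$, $f_\Omega(x)=0$ for $x\in\partial_m\Omega$; it is nonnegative. The $m$-torsional rigidity is $T_m(\Omega):=\int_\Omega f_\Omega\,d\nu$. The $m$-Cheeger constant is $h_1^m(\Omega):=\inf\{P_m(E)/\nu(E): E\in\mathcal{B},\ E\subset\Omega,\ \nu(E)>0\}$; $\Omega$ is $m$-calibrable if $h_1^m(\Omega)=P_m(\Omega)/\nu(\Omega)$. *)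

theory Defs
  imports "HOL-Probability.Probability"
begin

text \<open>
  The measurable space \<open>(X, \<B>)\<close> is \<open>(space \<nu>, sets \<nu>)\<close>. Quantities that may be infinite for a
  general \<sigma>-finite \<open>\<nu>\<close> (interaction, perimeter, Cheeger constant) take values in \<^typ>\<open>ennreal\<close>.
\<close>

definition countably_generated :: "'a measure \<Rightarrow> bool" where
  "countably_generated M \<longleftrightarrow>
     (\<exists>G. countable G \<and> G \<subseteq> Pow (space M) \<and> sets M = sigma_sets (space M) G)"

text \<open>
  Measurability into \<^const>\<open>prob_algebra\<close> says exactly that, for \<open>x \<in> X\<close>, \<open>m x\<close> is a probability
  measure on \<open>\<B>\<close> and that \<open>x \<mapsto> m x B\<close> is measurable for every \<open>B \<in> \<B>\<close>.
\<close>

definition random_walk :: "'a measure \<Rightarrow> ('a \<Rightarrow> 'a measure) \<Rightarrow> bool" where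
  "random_walk M m \<longleftrightarrow> countably_generated M \<and> m \<in> M \<rightarrow>\<^sub>M prob_algebra M"

definition reversible :: "('a \<Rightarrow> 'a measure) \<Rightarrow> 'a measure \<Rightarrow> bool" where
  "reversible m \<nu> \<longleftrightarrow>
     (\<forall>C \<in> sets (\<nu> \<Otimes>\<^sub>M \<nu>).
        (\<integral>\<^sup>+x. (\<integral>\<^sup>+y. indicator C (x, y) \<partial>m x) \<partial>\<nu>) =
        (\<integral>\<^sup>+y. (\<integral>\<^sup>+x. indicator C (x, y) \<partial>m y) \<partial>\<nu>))"

definition reversible_random_walk_space :: "('a \<Rightarrow> 'a measure) \<Rightarrow> 'a measure \<Rightarrow> bool" where
  "reversible_random_walk_space m \<nu> \<longleftrightarrow>
     random_walk \<nu> m \<and> sigma_finite_measure \<nu> \<and> reversible m \<nu>"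

definition m_interaction :: "('a \<Rightarrow> 'a measure) \<Rightarrow> 'a measure \<Rightarrow> 'a set \<Rightarrow> 'a set \<Rightarrow> ennreal" where
  "m_interaction m \<nu> A B = (\<integral>\<^sup>+x\<in>A. emeasure (m x) B \<partial>\<nu>)"

definition m_perimeter :: "('a \<Rightarrow> 'a measure) \<Rightarrow> 'a measure \<Rightarrow> 'a set \<Rightarrow> ennreal" where
  "m_perimeter m \<nu> E = m_interaction m \<nu> E (space \<nu> - E)"

definition m_boundary :: "('a \<Rightarrow> 'a measure) \<Rightarrow> 'a measure \<Rightarrow> 'a set \<Rightarrow> 'a set" where
  "m_boundary m \<nu> \<Omega> = {x \<in> space \<nu> - \<Omega>. emeasure (m x) \<Omega> > 0}"

definition m_closure :: "('a \<Rightarrow> 'a measure) \<Rightarrow> 'a measure \<Rightarrow> 'a set \<Rightarrow> 'a set" where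
  "m_closure m \<nu> \<Omega> = \<Omega> \<union> m_boundary m \<nu> \<Omega>"

definition m_connected :: "('a \<Rightarrow> 'a measure) \<Rightarrow> 'a measure \<Rightarrow> 'a set \<Rightarrow> bool" where
  "m_connected m \<nu> \<Omega> \<longleftrightarrow>
     \<Omega> \<in> sets \<nu> \<and> emeasure \<nu> \<Omega> > 0 \<and>
     (\<forall>A \<in> sets \<nu>. \<forall>B \<in> sets \<nu>.
        A \<subseteq> \<Omega> \<and> B \<subseteq> \<Omega> \<and> emeasure \<nu> A > 0 \<and> emeasure \<nu> B > 0 \<and> A \<union> B = \<Omega> \<longrightarrow>
        m_interaction m \<nu> A B > 0)"

text \<open>
  Square-integrable functions on \<open>S\<close>, represented by total functions; their values off \<open>S\<close>
  are irrelevant.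
\<close>

definition L2_on :: "'a measure \<Rightarrow> 'a set \<Rightarrow> ('a \<Rightarrow> real) \<Rightarrow> bool" where
  "L2_on \<nu> S f \<longleftrightarrow> set_borel_measurable \<nu> S f \<and> set_integrable \<nu> S (\<lambda>x. (f x)\<^sup>2)"

definition poincare_2 :: "('a \<Rightarrow> 'a measure) \<Rightarrow> 'a measure \<Rightarrow> 'a set \<Rightarrow> bool" where
  "poincare_2 m \<nu> \<Omega> \<longleftrightarrow>
     (\<exists>c::real. c > 0 \<and>
        (\<forall>f. L2_on \<nu> (m_closure m \<nu> \<Omega>) f \<and> (AE x in \<nu>. x \<in> m_boundary m \<nu> \<Omega> \<longrightarrow> f x = 0) \<longrightarrow>
           ennreal c * (\<integral>\<^sup>+x\<in>\<Omega>. ennreal (\<bar>f x\<bar>\<^sup>2) \<partial>\<nu>) \<le>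
           (\<integral>\<^sup>+x\<in>m_closure m \<nu> \<Omega>.
              (\<integral>\<^sup>+y\<in>m_closure m \<nu> \<Omega>. ennreal (\<bar>f y - f x\<bar>\<^sup>2) \<partial>m x) \<partial>\<nu>)))"

text \<open>
  A non-integrable integrand has Bochner integral \<open>0\<close>, so the equation on \<open>\<Omega>\<close> also
  forces \<open>f y - f x\<close> to be \<open>m x\<close>-integrable in \<open>y\<close>, for almost every \<open>x\<close>.
\<close>

definition is_m_stress_function ::
    "('a \<Rightarrow> 'a measure) \<Rightarrow> 'a measure \<Rightarrow> 'a set \<Rightarrow> ('a \<Rightarrow> real) \<Rightarrow> bool" where
  "is_m_stress_function m \<nu> \<Omega> f \<longleftrightarrow>
     L2_on \<nu> (m_closure m \<nu> \<Omega>) f \<and>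
     (AE x in \<nu>. x \<in> \<Omega> \<longrightarrow> - (LINT y:m_closure m \<nu> \<Omega>|m x. f y - f x) = 1) \<and>
     (AE x in \<nu>. x \<in> m_boundary m \<nu> \<Omega> \<longrightarrow> f x = 0)"

text \<open>
  Under a 2-Poincare inequality the solution is unique up to \<open>\<nu>\<close>-null sets on \<open>\<Omega>\<^sub>m\<close>. A
  representative is chosen; the torsional rigidity then does not depend on the choice.
\<close>

definition m_stress_function ::
    "('a \<Rightarrow> 'a measure) \<Rightarrow> 'a measure \<Rightarrow> 'a set \<Rightarrow> 'a \<Rightarrow> real" where
  "m_stress_function m \<nu> \<Omega> = (SOME f. is_m_stress_function m \<nu> \<Omega> f)"

definition m_torsional_rigidity :: "('a \<Rightarrow> 'a measure) \<Rightarrow> 'a measure \<Rightarrow> 'a set \<Rightarrow> real" where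
  "m_torsional_rigidity m \<nu> \<Omega> = (LINT x:\<Omega>|\<nu>. m_stress_function m \<nu> \<Omega> x)"

definition m_cheeger_constant :: "('a \<Rightarrow> 'a measure) \<Rightarrow> 'a measure \<Rightarrow> 'a set \<Rightarrow> ennreal" where
  "m_cheeger_constant m \<nu> \<Omega> =
     (INF E \<in> {E \<in> sets \<nu>. E \<subseteq> \<Omega> \<and> emeasure \<nu> E > 0}. m_perimeter m \<nu> E / emeasure \<nu> E)"

definition m_calibrable :: "('a \<Rightarrow> 'a measure) \<Rightarrow> 'a measure \<Rightarrow> 'a set \<Rightarrow> bool" where
  "m_calibrable m \<nu> \<Omega> \<longleftrightarrow> m_cheeger_constant m \<nu> \<Omega> = m_perimeter m \<nu> \<Omega> / emeasure \<nu> \<Omega>"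

end

theory Submission
  imports Defs
begin

text \<open>
  Extend the stress function by zero off \<open>\<Omega>\<close> to \<open>u\<close>, and let
  \<open>Q v w = \<integral>\<integral> (v x - v y) (w x - w y) dm\<^sub>x(y) d\<nu>(x)\<close>. Reversibility gives the Green formula
  \<open>Q u v = 2 \<integral> v d\<nu>\<close> for every \<open>v\<close> vanishing off \<open>\<Omega>\<close>; in particular \<open>Q u u = 2 T\<close>,
  \<open>Q u 1\<^sub>\<Omega> = 2 \<nu>(\<Omega>)\<close> and \<open>Q 1\<^sub>\<Omega> 1\<^sub>\<Omega> = 2 P\<close>. The lower bound is the Cauchy-Schwarz inequality for \<open>Q\<close>
  (where \<open>P > 0\<close> by the Poincare inequality applied to \<open>1\<^sub>\<Omega>\<close>).

  If \<open>\<Omega>\<close> is calibrable with Cheeger constant \<open>h\<close>, the coarea formula applied to \<open>\<bar>u\<bar>\<close> gives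
  \<open>2 h T \<le> \<integral>\<integral> \<bar>u x - u y\<bar> dm\<^sub>x(y) d\<nu>(x)\<close>, and \<open>\<bar>a\<bar> \<le> h a\<^sup>2 / 2 + 1 / (2 h)\<close> on the closure of \<open>\<Omega>\<close>
  bounds the right-hand side by \<open>h T + \<nu>(\<Omega>\<^sub>m) / (2 h)\<close>.
\<close>

section \<open>Elementary inequalities for squares\<close>

lemma abs_mult_le_sum_squares: "\<bar>a * b\<bar> \<le> a\<^sup>2 + b\<^sup>2" for a b :: real
proof -
  have "2 * (\<bar>a\<bar> * \<bar>b\<bar>) \<le> a\<^sup>2 + b\<^sup>2"
    using sum_squares_bound[of "\<bar>a\<bar>" "\<bar>b\<bar>"] by simp
  moreover have "0 \<le> \<bar>a\<bar> * \<bar>b\<bar>" by simp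
  ultimately show ?thesis unfolding abs_mult by linarith
qed

text \<open>The product of two suprema is a supremum over pairs \<open>(i, j)\<close>, and by
  monotonicity the index \<open>max i j\<close> serves both factors. This carries a uniform
  \<open>L\<^sup>2\<close> bound over to the limit of the Neumann iterates.\<close>

lemma ennreal_SUP_square:
  fixes g :: "nat \<Rightarrow> ennreal"
  assumes "incseq g"
  shows "(SUP n. g n)\<^sup>2 \<le> (SUP n. (g n)\<^sup>2)"
proof -
  have "g i * g j \<le> (SUP n. (g n)\<^sup>2)" for i j
  proof -
    have "g i * g j \<le> (g (max i j))\<^sup>2"
      unfolding power2_eq_square by (intro mult_mono incseqD[OF assms]) auto
    also have "\<dots> \<le> (SUP n. (g n)\<^sup>2)"
      by (rule SUP_upper) simp
    finally show ?thesis .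
  qed
  then show ?thesis
    unfolding power2_eq_square
    by (subst SUP_mult_right_ennreal, subst SUP_mult_left_ennreal) (intro SUP_least)
qed

section \<open>The measure of steps\<close>

text \<open>\<open>space_nonempty\<close> is there because \<open>edge_measure\<close> is built with
  \<open>bind\<close>, whose sigma-algebra is the intended one only over a nonempty space.\<close>

locale reversible_walk = sigma_finite_measure \<nu> for \<nu> :: "'a measure" +
  fixes m :: "'a \<Rightarrow> 'a measure"
  assumes kernel: "m \<in> \<nu> \<rightarrow>\<^sub>M prob_algebra \<nu>"
    and reversible: "reversible m \<nu>"
    and space_nonempty: "space \<nu> \<noteq> {}"
begin

lemma kernel_subprob [measurable]: "m \<in> \<nu> \<rightarrow>\<^sub>M subprob_algebra \<nu>"
  by (rule measurable_prob_algebraD[OF kernel])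

lemma prob_space_kernel: "x \<in> space \<nu> \<Longrightarrow> prob_space (m x)"
  using measurable_space[OF kernel] by (auto simp: space_prob_algebra)

lemma sets_kernel: "x \<in> space \<nu> \<Longrightarrow> sets (m x) = sets \<nu>"
  using measurable_space[OF kernel] by (auto simp: space_prob_algebra)

lemma space_kernel: "x \<in> space \<nu> \<Longrightarrow> space (m x) = space \<nu>"
  by (rule sets_eq_imp_space_eq[OF sets_kernel])

lemma measurable_kernel: "x \<in> space \<nu> \<Longrightarrow> (f \<in> m x \<rightarrow>\<^sub>M N) = (f \<in> \<nu> \<rightarrow>\<^sub>M N)"
  by (simp add: sets_kernel cong: measurable_cong_sets)

text \<open>
  The law of a step \<open>(x, y)\<close> with \<open>x\<close> distributed by \<open>\<nu>\<close>; reversibility is its invariance under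
  exchanging \<open>x\<close> and \<open>y\<close>.
\<close>

definition edge_measure :: "('a \<times> 'a) measure" where
  "edge_measure = \<nu> \<bind> (\<lambda>x. distr (m x) (\<nu> \<Otimes>\<^sub>M \<nu>) (Pair x))"

lemma edge_kernel [measurable]:
  "(\<lambda>x. distr (m x) (\<nu> \<Otimes>\<^sub>M \<nu>) (Pair x)) \<in> \<nu> \<rightarrow>\<^sub>M subprob_algebra (\<nu> \<Otimes>\<^sub>M \<nu>)"
  by (rule measurable_distr2[where M = \<nu>]) simp_all

lemma sets_edge [measurable_cong, simp]: "sets edge_measure = sets (\<nu> \<Otimes>\<^sub>M \<nu>)"
  unfolding edge_measure_def by (rule sets_bind) (simp_all add: space_nonempty)

lemma space_edge [simp]: "space edge_measure = space \<nu> \<times> space \<nu>"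
  using sets_eq_imp_space_eq[OF sets_edge] by (simp add: space_pair_measure)

lemma measurable_Pair_kernel: "x \<in> space \<nu> \<Longrightarrow> Pair x \<in> m x \<rightarrow>\<^sub>M \<nu> \<Otimes>\<^sub>M \<nu>"
  by (simp add: measurable_kernel)

lemma nn_integral_edge:
  assumes [measurable]: "F \<in> borel_measurable (\<nu> \<Otimes>\<^sub>M \<nu>)"
  shows "(\<integral>\<^sup>+p. F p \<partial>edge_measure) = (\<integral>\<^sup>+x. \<integral>\<^sup>+y. F (x, y) \<partial>m x \<partial>\<nu>)"
  unfolding edge_measure_def
  by (subst nn_integral_bind[OF assms edge_kernel], intro nn_integral_cong)
     (simp add: nn_integral_distr[OF measurable_Pair_kernel])

lemma AE_edge:
  assumes [measurable]: "Measurable.pred (\<nu> \<Otimes>\<^sub>M \<nu>) P"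
  shows "(AE p in edge_measure. P p) \<longleftrightarrow> (AE x in \<nu>. AE y in m x. P (x, y))"
  unfolding edge_measure_def
  by (subst AE_bind[OF edge_kernel assms], intro AE_cong)
     (simp add: AE_distr_iff[OF measurable_Pair_kernel] pred_def[symmetric])

lemma distr_edge_swap: "distr edge_measure (\<nu> \<Otimes>\<^sub>M \<nu>) (\<lambda>(x, y). (y, x)) = edge_measure"
proof (rule measure_eqI)
  fix C assume "C \<in> sets (distr edge_measure (\<nu> \<Otimes>\<^sub>M \<nu>) (\<lambda>(x, y). (y, x)))"
  then have C [measurable]: "C \<in> sets (\<nu> \<Otimes>\<^sub>M \<nu>)" by simp
  have "emeasure (distr edge_measure (\<nu> \<Otimes>\<^sub>M \<nu>) (\<lambda>(x, y). (y, x))) C =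
      (\<integral>\<^sup>+p. indicator C p \<partial>distr edge_measure (\<nu> \<Otimes>\<^sub>M \<nu>) (\<lambda>(x, y). (y, x)))"
    by simp
  also have "\<dots> = (\<integral>\<^sup>+p. indicator C (snd p, fst p) \<partial>edge_measure)"
    by (subst nn_integral_distr) (auto simp: case_prod_beta)
  also have "\<dots> = (\<integral>\<^sup>+x. \<integral>\<^sup>+y. indicator C (y, x) \<partial>m x \<partial>\<nu>)"
    by (subst nn_integral_edge) auto
  also have "\<dots> = (\<integral>\<^sup>+x. \<integral>\<^sup>+y. indicator C (x, y) \<partial>m x \<partial>\<nu>)"
    using reversible C by (auto simp: reversible_def)
  also have "\<dots> = (\<integral>\<^sup>+p. indicator C p \<partial>edge_measure)"
    by (subst nn_integral_edge) auto
  finally show "emeasure (distr edge_measure (\<nu> \<Otimes>\<^sub>M \<nu>) (\<lambda>(x, y). (y, x))) C = emeasure edge_measure C"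
    by simp
qed simp

section \<open>Marginals of the measure of steps\<close>

lemma distr_edge_fst: "distr edge_measure \<nu> fst = \<nu>"
proof (rule measure_eqI)
  fix A assume "A \<in> sets (distr edge_measure \<nu> fst)"
  then have A [measurable]: "A \<in> sets \<nu>" by simp
  have "emeasure (distr edge_measure \<nu> fst) A = (\<integral>\<^sup>+p. indicator A (fst p) \<partial>edge_measure)"
    by (subst nn_integral_distr[symmetric, where M' = \<nu>]) auto
  also have "\<dots> = (\<integral>\<^sup>+x. \<integral>\<^sup>+y. indicator A x \<partial>m x \<partial>\<nu>)"
    by (subst nn_integral_edge) auto
  also have "\<dots> = (\<integral>\<^sup>+x. indicator A x \<partial>\<nu>)"
    by (intro nn_integral_cong) (simp add: prob_space.emeasure_space_1[OF prob_space_kernel])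
  finally show "emeasure (distr edge_measure \<nu> fst) A = emeasure \<nu> A"
    by simp
qed simp

text \<open>This is the invariance of \<open>\<nu>\<close> under the walk: exchanging the
  coordinates preserves the measure and turns the second marginal into the first.\<close>

lemma distr_edge_snd: "distr edge_measure \<nu> snd = \<nu>"
proof -
  have "distr edge_measure \<nu> snd = distr (distr edge_measure (\<nu> \<Otimes>\<^sub>M \<nu>) (\<lambda>(x, y). (y, x))) \<nu> fst"
    by (subst distr_distr) (auto simp: comp_def case_prod_beta)
  then show ?thesis
    by (simp add: distr_edge_swap distr_edge_fst)
qed

text \<open>An exhaustion of \<open>\<nu>\<close> pulls back along \<open>fst\<close>. The coarea
  argument relies on this for Fubini against Lebesgue measure.\<close>

lemma sigma_finite_edge: "sigma_finite_measure edge_measure"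
proof (rule sigma_finite_measure_distr[where f = fst])
  show "sigma_finite_measure (distr edge_measure \<nu> fst)"
    unfolding distr_edge_fst by unfold_locales
qed simp

lemma AE_edge_snd: "AE x in \<nu>. P x \<Longrightarrow> AE p in edge_measure. P (snd p)"
  using AE_distrD[of snd edge_measure \<nu> P] unfolding distr_edge_snd by simp

text \<open>By invariance of \<open>\<nu>\<close>, a \<open>\<nu>\<close>-null set is
  \<open>m x\<close>-null for almost every \<open>x\<close>, so equalities that hold
  \<open>\<nu>\<close>-almost everywhere may be used under the inner integral. As \<open>P\<close>
  may fail to be measurable, the argument runs through a measurable null set \<open>N\<close>
  covering the exceptions.\<close>

lemma AE_kernel:
  assumes "AE x in \<nu>. P x"
  shows "AE x in \<nu>. AE y in m x. P y"
proof -
  obtain N where N: "{x \<in> space \<nu>. \<not> P x} \<subseteq> N" "N \<in> sets \<nu>" "emeasure \<nu> N = 0"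
    using assms by (auto elim: AE_E)
  have "AE x in \<nu>. x \<notin> N"
    using N by (intro AE_not_in) auto
  from AE_edge_snd[OF this] have "AE x in \<nu>. AE y in m x. y \<notin> N"
    using N(2) by (subst (asm) AE_edge) auto
  then show ?thesis
  proof (rule AE_mp, intro AE_I2[where M = \<nu>] impI)
    fix x assume x: "x \<in> space \<nu>" and "AE y in m x. y \<notin> N"
    then show "AE y in m x. P y"
    proof (elim AE_mp, intro AE_I2 impI)
      fix y assume "y \<in> space (m x)" "y \<notin> N"
      then show "P y" using N(1) x by (auto simp: space_kernel)
    qed
  qed
qed

section \<open>Change of variables and Fubini for the measure of steps\<close>

lemma nn_integral_edge_swap:
  assumes [measurable]: "F \<in> borel_measurable (\<nu> \<Otimes>\<^sub>M \<nu>)"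
  shows "(\<integral>\<^sup>+p. F (snd p, fst p) \<partial>edge_measure) = (\<integral>\<^sup>+p. F p \<partial>edge_measure)"
proof -
  have "(\<integral>\<^sup>+p. F p \<partial>edge_measure) = (\<integral>\<^sup>+p. F p \<partial>distr edge_measure (\<nu> \<Otimes>\<^sub>M \<nu>) (\<lambda>(x, y). (y, x)))"
    by (simp only: distr_edge_swap)
  also have "\<dots> = (\<integral>\<^sup>+p. F (snd p, fst p) \<partial>edge_measure)"
    by (subst nn_integral_distr) (auto simp: case_prod_beta)
  finally show ?thesis by simp
qed

lemma integral_edge_swap:
  fixes F :: "'a \<times> 'a \<Rightarrow> real"
  assumes [measurable]: "F \<in> borel_measurable (\<nu> \<Otimes>\<^sub>M \<nu>)"
  shows "(\<integral>p. F (snd p, fst p) \<partial>edge_measure) = (\<integral>p. F p \<partial>edge_measure)"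
  using integral_distr[of "\<lambda>(x, y). (y, x)" edge_measure "\<nu> \<Otimes>\<^sub>M \<nu>" F]
  by (simp add: distr_edge_swap case_prod_beta)

lemma integrable_edge_swap:
  fixes F :: "'a \<times> 'a \<Rightarrow> real"
  assumes [measurable]: "F \<in> borel_measurable (\<nu> \<Otimes>\<^sub>M \<nu>)"
  shows "integrable edge_measure (\<lambda>p. F (snd p, fst p)) \<longleftrightarrow> integrable edge_measure F"
  using integrable_distr_eq[of "\<lambda>(x, y). (y, x)" edge_measure "\<nu> \<Otimes>\<^sub>M \<nu>" F]
  by (simp add: distr_edge_swap case_prod_beta)

lemma integral_edge_fst:
  fixes f :: "'a \<Rightarrow> real"
  assumes [measurable]: "f \<in> borel_measurable \<nu>"
  shows "(\<integral>p. f (fst p) \<partial>edge_measure) = (\<integral>x. f x \<partial>\<nu>)"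
  using integral_distr[of fst edge_measure \<nu> f] by (simp add: distr_edge_fst)

lemma integrable_edge_fst:
  fixes f :: "'a \<Rightarrow> real"
  assumes [measurable]: "f \<in> borel_measurable \<nu>"
  shows "integrable edge_measure (\<lambda>p. f (fst p)) \<longleftrightarrow> integrable \<nu> f"
  using integrable_distr_eq[of fst edge_measure \<nu> f] by (simp add: distr_edge_fst)

lemma integrable_edge_snd:
  fixes f :: "'a \<Rightarrow> real"
  assumes [measurable]: "f \<in> borel_measurable \<nu>"
  shows "integrable edge_measure (\<lambda>p. f (snd p)) \<longleftrightarrow> integrable \<nu> f"
  using integrable_distr_eq[of snd edge_measure \<nu> f] by (simp add: distr_edge_snd)

lemma AE_integrable_edge:
  fixes F :: "'a \<times> 'a \<Rightarrow> real"
  assumes F: "integrable edge_measure F"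
  shows "AE x in \<nu>. integrable (m x) (\<lambda>y. F (x, y))"
proof -
  have [measurable]: "F \<in> borel_measurable (\<nu> \<Otimes>\<^sub>M \<nu>)"
    using borel_measurable_integrable[OF F] by (simp cong: measurable_cong_sets)
  have "(\<integral>\<^sup>+x. \<integral>\<^sup>+y. ennreal \<bar>F (x, y)\<bar> \<partial>m x \<partial>\<nu>) = (\<integral>\<^sup>+p. ennreal \<bar>F p\<bar> \<partial>edge_measure)"
    by (rule nn_integral_edge[symmetric]) simp
  also have "\<dots> \<noteq> \<infinity>"
    using F by (auto simp: integrable_iff_bounded)
  finally have "AE x in \<nu>. (\<integral>\<^sup>+y. ennreal \<bar>F (x, y)\<bar> \<partial>m x) \<noteq> \<infinity>"
    by (intro nn_integral_PInf_AE nn_integral_measurable_subprob_algebra2[where N = \<nu>]) auto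
  then show ?thesis
  proof (rule AE_mp, intro AE_I2 impI)
    fix x assume x: "x \<in> space \<nu>" and "(\<integral>\<^sup>+y. ennreal \<bar>F (x, y)\<bar> \<partial>m x) \<noteq> \<infinity>"
    then show "integrable (m x) (\<lambda>y. F (x, y))"
      by (intro integrableI_bounded) (auto simp: measurable_kernel less_top)
  qed
qed

lemma integral_edge:
  fixes F :: "'a \<times> 'a \<Rightarrow> real"
  assumes F: "integrable edge_measure F"
  shows "integrable \<nu> (\<lambda>x. \<integral>y. F (x, y) \<partial>m x)"
    and "(\<integral>p. F p \<partial>edge_measure) = (\<integral>x. \<integral>y. F (x, y) \<partial>m x \<partial>\<nu>)"
proof -
  have nonneg: "integrable \<nu> (\<lambda>x. \<integral>y. G (x, y) \<partial>m x) \<and>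
      (\<integral>p. G p \<partial>edge_measure) = (\<integral>x. \<integral>y. G (x, y) \<partial>m x \<partial>\<nu>)"
    if G: "integrable edge_measure G" and pos: "\<And>p. 0 \<le> G p" for G :: "'a \<times> 'a \<Rightarrow> real"
  proof -
    have [measurable]: "G \<in> borel_measurable (\<nu> \<Otimes>\<^sub>M \<nu>)"
      using borel_measurable_integrable[OF G] by (simp cong: measurable_cong_sets)
    let ?g = "\<lambda>x. \<integral>\<^sup>+y. ennreal (G (x, y)) \<partial>m x"
    have [measurable]: "?g \<in> borel_measurable \<nu>"
      by (rule nn_integral_measurable_subprob_algebra2[where N = \<nu>]) auto
    have eq: "(\<integral>y. G (x, y) \<partial>m x) = enn2real (?g x)" if "x \<in> space \<nu>" for x
      using that by (intro integral_eq_nn_integral) (auto simp: measurable_kernel pos)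
    have [measurable]: "(\<lambda>x. \<integral>y. G (x, y) \<partial>m x) \<in> borel_measurable \<nu>"
      by (subst measurable_cong[OF eq]) auto
    have "AE x in \<nu>. ennreal (\<integral>y. G (x, y) \<partial>m x) = ?g x"
      using AE_integrable_edge[OF G] by (auto elim!: AE_mp simp: nn_integral_eq_integral pos)
    then have "(\<integral>\<^sup>+x. ennreal (\<integral>y. G (x, y) \<partial>m x) \<partial>\<nu>) = (\<integral>\<^sup>+x. ?g x \<partial>\<nu>)"
      by (rule nn_integral_cong_AE)
    also have "\<dots> = (\<integral>\<^sup>+p. ennreal (G p) \<partial>edge_measure)"
      by (subst nn_integral_edge) auto
    also have "\<dots> = ennreal (\<integral>p. G p \<partial>edge_measure)"
      by (rule nn_integral_eq_integral[OF G]) (simp add: pos)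
    finally have "has_bochner_integral \<nu> (\<lambda>x. \<integral>y. G (x, y) \<partial>m x) (\<integral>p. G p \<partial>edge_measure)"
      by (intro has_bochner_integral_nn_integral) (auto simp: pos)
    then show ?thesis
      by (auto simp: has_bochner_integral_iff)
  qed
  let ?P = "\<lambda>p. max 0 (F p)" and ?N = "\<lambda>p. max 0 (- F p)"
  have P: "integrable edge_measure ?P" and N: "integrable edge_measure ?N"
    using F by auto
  have FPN: "F p = ?P p - ?N p" for p by auto
  have [measurable]: "F \<in> borel_measurable (\<nu> \<Otimes>\<^sub>M \<nu>)"
    using borel_measurable_integrable[OF F] by (simp cong: measurable_cong_sets)
  \<comment> \<open>Measurability in \<open>x\<close> of the inner integral: the integrand is made
    independent of \<open>x\<close> by moving the dependence into a measurable family of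
    measures.\<close>
  have "(\<integral>y. F (x, y) \<partial>m x) = (\<integral>p. F p \<partial>distr (m x) (\<nu> \<Otimes>\<^sub>M \<nu>) (Pair x))" if "x \<in> space \<nu>" for x
    by (rule integral_distr[symmetric, OF measurable_Pair_kernel[OF that]]) simp
  then have meas: "(\<lambda>x. \<integral>y. F (x, y) \<partial>m x) \<in> borel_measurable \<nu>"
    by (subst measurable_cong)
       (auto intro: measurable_compose[OF edge_kernel integral_measurable_subprob_algebra])
  \<comment> \<open>Only almost everywhere: if just one of the two parts is non-integrable for some
    \<open>x\<close>, its default integral 0 may spoil the subtraction.\<close>
  have AE: "AE x in \<nu>. (\<integral>y. ?P (x, y) \<partial>m x) - (\<integral>y. ?N (x, y) \<partial>m x) = (\<integral>y. F (x, y) \<partial>m x)"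
    using AE_integrable_edge[OF P] AE_integrable_edge[OF N]
    by (auto elim!: AE_mp simp: Bochner_Integration.integral_diff[symmetric] FPN[symmetric])
  note P' = nonneg[OF P] and N' = nonneg[OF N]
  have I: "integrable \<nu> (\<lambda>x. (\<integral>y. ?P (x, y) \<partial>m x) - (\<integral>y. ?N (x, y) \<partial>m x))"
    using P' N' by (intro Bochner_Integration.integrable_diff) auto
  show "integrable \<nu> (\<lambda>x. \<integral>y. F (x, y) \<partial>m x)"
    by (rule integrable_cong_AE_imp[OF I meas AE])
  have "(\<integral>p. F p \<partial>edge_measure) = (\<integral>p. ?P p \<partial>edge_measure) - (\<integral>p. ?N p \<partial>edge_measure)"
    using P N by (subst Bochner_Integration.integral_diff[symmetric]) (auto simp: FPN[symmetric])
  also have "\<dots> = (\<integral>x. (\<integral>y. ?P (x, y) \<partial>m x) - (\<integral>y. ?N (x, y) \<partial>m x) \<partial>\<nu>)"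
    using P' N' by (subst Bochner_Integration.integral_diff) auto
  also have "\<dots> = (\<integral>x. \<integral>y. F (x, y) \<partial>m x \<partial>\<nu>)"
    by (rule integral_cong_AE[OF borel_measurable_integrable[OF I] meas AE])
  finally show "(\<integral>p. F p \<partial>edge_measure) = (\<integral>x. \<integral>y. F (x, y) \<partial>m x \<partial>\<nu>)" .
qed

section \<open>The Dirichlet form\<close>

definition square_integrable :: "('a \<Rightarrow> real) \<Rightarrow> bool" where
  "square_integrable u \<longleftrightarrow> u \<in> borel_measurable \<nu> \<and> integrable \<nu> (\<lambda>x. (u x)\<^sup>2)"

lemma square_integrableD:
  assumes "square_integrable u"
  shows "u \<in> borel_measurable \<nu>" "integrable \<nu> (\<lambda>x. (u x)\<^sup>2)"
  using assms by (auto simp: square_integrable_def)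

text \<open>Both marginals are \<open>\<nu>\<close>, so either coordinate keeps squares integrable,
  and the product is dominated by the sum of squares. Letting \<open>s\<close> and \<open>t\<close>
  range over the projections covers all four terms of an expanded gradient product.\<close>

lemma integrable_edge_mult:
  assumes u: "square_integrable u" and v: "square_integrable v"
    and s: "s = fst \<or> s = snd" and t: "t = fst \<or> t = snd"
  shows "integrable edge_measure (\<lambda>p. u (s p) * v (t p))"
proof -
  note [measurable] = square_integrableD(1)[OF u] square_integrableD(1)[OF v]
  have [measurable]: "s \<in> \<nu> \<Otimes>\<^sub>M \<nu> \<rightarrow>\<^sub>M \<nu>" "t \<in> \<nu> \<Otimes>\<^sub>M \<nu> \<rightarrow>\<^sub>M \<nu>"
    using s t by auto
  have "integrable edge_measure (\<lambda>p. (u (s p))\<^sup>2)" "integrable edge_measure (\<lambda>p. (v (t p))\<^sup>2)"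
    using s t square_integrableD(2)[OF u] square_integrableD(2)[OF v]
      integrable_edge_fst[of "\<lambda>x. (u x)\<^sup>2"] integrable_edge_snd[of "\<lambda>x. (u x)\<^sup>2"]
      integrable_edge_fst[of "\<lambda>x. (v x)\<^sup>2"] integrable_edge_snd[of "\<lambda>x. (v x)\<^sup>2"]
    by auto
  then have "integrable edge_measure (\<lambda>p. (u (s p))\<^sup>2 + (v (t p))\<^sup>2)"
    by (rule Bochner_Integration.integrable_add)
  then show ?thesis
    by (rule Bochner_Integration.integrable_bound)
       (auto intro!: AE_I2 order_trans[OF abs_mult_le_sum_squares])
qed

lemma integrable_edge_gradient:
  assumes u: "square_integrable u" and v: "square_integrable v"
  shows "integrable edge_measure (\<lambda>p. (u (fst p) - u (snd p)) * (v (fst p) - v (snd p)))"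
    and "integrable edge_measure (\<lambda>p. (u (fst p) - u (snd p)) * v (fst p))"
  unfolding left_diff_distrib right_diff_distrib
  by (intro Bochner_Integration.integrable_diff integrable_edge_mult[OF u v]; simp)+

text \<open>The form \<open>Q\<close>, without the customary factor one half; the factors 2 below
  come from this.\<close>

definition dirichlet :: "('a \<Rightarrow> real) \<Rightarrow> ('a \<Rightarrow> real) \<Rightarrow> real" where
  "dirichlet u v = (\<integral>p. (u (fst p) - u (snd p)) * (v (fst p) - v (snd p)) \<partial>edge_measure)"

text \<open>The sign makes the operator nonnegative, so that the stress equation reads
  \<open>laplacian u x = 1\<close> on \<open>\<Omega>\<close>.\<close>

definition laplacian :: "('a \<Rightarrow> real) \<Rightarrow> 'a \<Rightarrow> real" where
  "laplacian u x = (\<integral>y. (u x - u y) \<partial>m x)"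

text \<open>With \<open>?G\<close> the gradient of \<open>u\<close> times \<open>v\<close> at the
  starting point, the integrand of \<open>dirichlet u v\<close> is \<open>?G\<close> plus
  \<open>?G\<close> with the coordinates exchanged. The two have equal integrals by reversibility,
  whence the factor 2.\<close>

lemma Green_formula:
  assumes u: "square_integrable u" and v: "square_integrable v"
  shows "integrable \<nu> (\<lambda>x. v x * laplacian u x)"
    and "dirichlet u v = 2 * (\<integral>x. v x * laplacian u x \<partial>\<nu>)"
proof -
  note [measurable] = square_integrableD(1)[OF u] square_integrableD(1)[OF v]
  let ?G = "\<lambda>p. (u (fst p) - u (snd p)) * v (fst p)"
  have [measurable]: "?G \<in> borel_measurable (\<nu> \<Otimes>\<^sub>M \<nu>)" by measurable
  have G: "integrable edge_measure ?G"
    by (rule integrable_edge_gradient(2)[OF u v])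
  then have G': "integrable edge_measure (\<lambda>p. ?G (snd p, fst p))"
    by (subst integrable_edge_swap) simp_all
  have eq: "(\<integral>y. ?G (x, y) \<partial>m x) = v x * laplacian u x" for x
    by (simp add: laplacian_def mult.commute[of _ "v x"])
  show "integrable \<nu> (\<lambda>x. v x * laplacian u x)"
    using integral_edge(1)[OF G] unfolding eq .
  have "dirichlet u v = (\<integral>p. ?G p + ?G (snd p, fst p) \<partial>edge_measure)"
    unfolding dirichlet_def by (intro Bochner_Integration.integral_cong) (auto simp: algebra_simps)
  also have "\<dots> = (\<integral>p. ?G p \<partial>edge_measure) + (\<integral>p. ?G (snd p, fst p) \<partial>edge_measure)"
    by (rule Bochner_Integration.integral_add[OF G G'])
  also have "\<dots> = 2 * (\<integral>p. ?G p \<partial>edge_measure)"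
    by (subst integral_edge_swap) simp_all
  also have "(\<integral>p. ?G p \<partial>edge_measure) = (\<integral>x. v x * laplacian u x \<partial>\<nu>)"
    using integral_edge(2)[OF G] unfolding eq .
  finally show "dirichlet u v = 2 * (\<integral>x. v x * laplacian u x \<partial>\<nu>)" .
qed

lemma dirichlet_nonneg: "0 \<le> dirichlet u u"
  by (simp add: dirichlet_def)

section \<open>The closure of the domain and functions restricted to the domain\<close>

lemma sets_m_closure [measurable]:
  assumes [measurable]: "\<Omega> \<in> sets \<nu>"
  shows "m_closure m \<nu> \<Omega> \<in> sets \<nu>"
proof -
  have "(\<lambda>x. emeasure (m x) \<Omega>) \<in> borel_measurable \<nu>" by measurable
  then have "{x \<in> space \<nu>. 0 < emeasure (m x) \<Omega>} \<in> sets \<nu>" by measurable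
  then have "{x \<in> space \<nu>. 0 < emeasure (m x) \<Omega>} - \<Omega> \<in> sets \<nu>" by auto
  also have "{x \<in> space \<nu>. 0 < emeasure (m x) \<Omega>} - \<Omega> = m_boundary m \<nu> \<Omega>"
    by (auto simp: m_boundary_def)
  finally show ?thesis
    by (auto simp: m_closure_def)
qed

text \<open>A point outside the closure gives \<open>\<Omega>\<close> zero probability, by the
  definition of the boundary; this is the second claim. Exchanging the coordinates yields the
  first.\<close>

lemma AE_edge_closure:
  assumes [measurable]: "\<Omega> \<in> sets \<nu>"
  shows "AE p in edge_measure. fst p \<in> \<Omega> \<longrightarrow> snd p \<in> m_closure m \<nu> \<Omega>"
    and "AE p in edge_measure. snd p \<in> \<Omega> \<longrightarrow> fst p \<in> m_closure m \<nu> \<Omega>"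
proof -
  have "AE y in m x. y \<in> \<Omega> \<longrightarrow> x \<in> m_closure m \<nu> \<Omega>" if x: "x \<in> space \<nu>" for x
  proof (cases "x \<in> m_closure m \<nu> \<Omega>")
    case False
    then have "emeasure (m x) \<Omega> = 0"
      using x by (auto simp: m_closure_def m_boundary_def)
    then have "AE y in m x. y \<notin> \<Omega>"
      using x by (intro AE_not_in) (auto simp: null_sets_def sets_kernel)
    then show ?thesis by (rule eventually_mono) auto
  qed auto
  then show *: "AE p in edge_measure. snd p \<in> \<Omega> \<longrightarrow> fst p \<in> m_closure m \<nu> \<Omega>"
    by (subst AE_edge) auto
  then have "AE p in distr edge_measure (\<nu> \<Otimes>\<^sub>M \<nu>) (\<lambda>(x, y). (y, x)).
      snd p \<in> \<Omega> \<longrightarrow> fst p \<in> m_closure m \<nu> \<Omega>"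
    by (simp only: distr_edge_swap)
  from AE_distrD[OF _ this]
  show "AE p in edge_measure. fst p \<in> \<Omega> \<longrightarrow> snd p \<in> m_closure m \<nu> \<Omega>"
    by (auto simp: case_prod_beta)
qed

lemma L2_on_closure_restrict:
  assumes [measurable]: "\<Omega> \<in> sets \<nu>" and f: "L2_on \<nu> (m_closure m \<nu> \<Omega>) f"
  shows "square_integrable (\<lambda>x. indicator \<Omega> x * f x)"
proof -
  let ?C = "m_closure m \<nu> \<Omega>"
  have sub: "\<Omega> \<subseteq> ?C" by (auto simp: m_closure_def)
  have [measurable]: "(\<lambda>x. indicator ?C x * f x) \<in> borel_measurable \<nu>"
    using f by (simp add: L2_on_def set_borel_measurable_def)
  \<comment> \<open>\<open>L2_on\<close> guarantees measurability only of \<open>f\<close> cut off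
    to the closure, so the cutoff to \<open>\<Omega>\<close> is factored through it.\<close>
  have eq: "indicator \<Omega> x * f x = indicator \<Omega> x * (indicator ?C x * f x)" for x
    using sub by (auto simp: indicator_def)
  have [measurable]: "(\<lambda>x. indicator \<Omega> x * f x) \<in> borel_measurable \<nu>"
    unfolding eq by measurable
  have "integrable \<nu> (\<lambda>x. indicator ?C x * (f x)\<^sup>2)"
    using f by (simp add: L2_on_def set_integrable_def)
  then have "integrable \<nu> (\<lambda>x. (indicator \<Omega> x * f x)\<^sup>2)"
  proof (rule Bochner_Integration.integrable_bound)
    show "(\<lambda>x. (indicator \<Omega> x * f x)\<^sup>2) \<in> borel_measurable \<nu>" by measurable
  qed (use sub in \<open>auto simp: indicator_def intro!: AE_I2\<close>)
  then show ?thesis by (simp add: square_integrable_def)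
qed

text \<open>
  Almost every step from \<open>\<Omega>\<close> stays in its closure, so extending \<open>f\<close> by zero off \<open>\<Omega>\<close> turns the
  equation over the closure into one over the whole space.
\<close>

lemma set_integral_closure_eq_laplacian:
  assumes [measurable]: "\<Omega> \<in> sets \<nu>" and f: "L2_on \<nu> (m_closure m \<nu> \<Omega>) f"
    and 0: "AE x in \<nu>. x \<in> m_boundary m \<nu> \<Omega> \<longrightarrow> f x = 0"
  shows "AE x in \<nu>. x \<in> \<Omega> \<longrightarrow>
    - (LINT y:m_closure m \<nu> \<Omega>|m x. f y - f x) = laplacian (\<lambda>x. indicator \<Omega> x * f x) x"
proof -
  let ?C = "m_closure m \<nu> \<Omega>" and ?u = "\<lambda>x. indicator \<Omega> x * f x :: real"
  have meas [measurable]: "(\<lambda>x. indicator ?C x * f x) \<in> borel_measurable \<nu>"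
    using f by (simp add: L2_on_def set_borel_measurable_def)
  have [measurable]: "?u \<in> borel_measurable \<nu>"
    using L2_on_closure_restrict[OF assms(1) f] by (rule square_integrableD)
  have "AE x in \<nu>. AE y in m x. x \<in> \<Omega> \<longrightarrow> y \<in> ?C"
    using AE_edge_closure(1)[OF assms(1)] by (subst (asm) AE_edge) auto
  with AE_kernel[OF 0] show ?thesis
  proof eventually_elim
    case (elim x)
    show ?case
    proof
      assume x: "x \<in> \<Omega>"
      have xs: "x \<in> space \<nu>" using x sets.sets_into_space[OF assms(1)] by auto
      \<comment> \<open>Almost every \<open>y\<close> lies in the closure, and there
        \<open>f y = ?u y\<close>, since \<open>f\<close> vanishes almost everywhere on the
        boundary; \<open>f x = ?u x\<close> because \<open>x\<close> is in
        \<open>\<Omega>\<close>.\<close>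
      have ae: "AE y in m x. indicator ?C y *\<^sub>R (f y - f x) = - (?u x - ?u y)"
        using elim(1,2) by eventually_elim (use x in \<open>auto simp: m_closure_def indicator_def\<close>)
      have "(\<lambda>y. indicator ?C y * f y - indicator ?C y * f x) \<in> borel_measurable (m x)"
        by (subst measurable_kernel[OF xs]) measurable
      then have "(\<lambda>y. indicator ?C y *\<^sub>R (f y - f x)) \<in> borel_measurable (m x)"
        by (simp add: right_diff_distrib)
      moreover have "(\<lambda>y. - (?u x - ?u y)) \<in> borel_measurable (m x)"
        by (subst measurable_kernel[OF xs]) measurable
      ultimately have "(\<integral>y. indicator ?C y *\<^sub>R (f y - f x) \<partial>m x) = (\<integral>y. - (?u x - ?u y) \<partial>m x)"
        using ae by (rule integral_cong_AE)
      also have "\<dots> = - laplacian ?u x"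
        unfolding laplacian_def by (rule Bochner_Integration.integral_minus)
      finally show "- (LINT y:?C|m x. f y - f x) = laplacian ?u x"
        by (simp add: set_lebesgue_integral_def)
    qed
  qed
qed

text \<open>Passing from the closure to the whole space only enlarges the energy, and for
  square-integrable functions both sides are finite, so the inequality can be stated for real
  integrals.\<close>

lemma poincare_dirichlet:
  assumes [measurable]: "\<Omega> \<in> sets \<nu>" and "poincare_2 m \<nu> \<Omega>"
  obtains c where "0 < c" "\<And>u. square_integrable u \<Longrightarrow> (\<And>x. x \<notin> \<Omega> \<Longrightarrow> u x = 0) \<Longrightarrow>
    c * (\<integral>x. (u x)\<^sup>2 \<partial>\<nu>) \<le> dirichlet u u"
proof -
  let ?C = "m_closure m \<nu> \<Omega>"
  obtain c where c: "0 < c" and P: "\<And>f. L2_on \<nu> ?C f \<Longrightarrow> AE x in \<nu>. x \<in> m_boundary m \<nu> \<Omega> \<longrightarrow> f x = 0 \<Longrightarrow>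
      ennreal c * (\<integral>\<^sup>+x\<in>\<Omega>. ennreal (\<bar>f x\<bar>\<^sup>2) \<partial>\<nu>) \<le>
      (\<integral>\<^sup>+x\<in>?C. (\<integral>\<^sup>+y\<in>?C. ennreal (\<bar>f y - f x\<bar>\<^sup>2) \<partial>m x) \<partial>\<nu>)"
    using assms(2) unfolding poincare_2_def by blast
  have "c * (\<integral>x. (u x)\<^sup>2 \<partial>\<nu>) \<le> dirichlet u u"
    if u: "square_integrable u" and 0: "\<And>x. x \<notin> \<Omega> \<Longrightarrow> u x = 0" for u
  proof -
    note [measurable] = square_integrableD(1)[OF u]
    have "L2_on \<nu> ?C u"
      unfolding L2_on_def set_borel_measurable_def set_integrable_def
      using integrable_mult_indicator[OF sets_m_closure[OF assms(1)] square_integrableD(2)[OF u]] by auto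
    moreover have "AE x in \<nu>. x \<in> m_boundary m \<nu> \<Omega> \<longrightarrow> u x = 0"
      by (auto intro!: AE_I2 0 simp: m_boundary_def)
    ultimately have "ennreal c * (\<integral>\<^sup>+x\<in>\<Omega>. ennreal (\<bar>u x\<bar>\<^sup>2) \<partial>\<nu>) \<le>
        (\<integral>\<^sup>+x\<in>?C. (\<integral>\<^sup>+y\<in>?C. ennreal (\<bar>u y - u x\<bar>\<^sup>2) \<partial>m x) \<partial>\<nu>)"
      by (rule P)
    also have "\<dots> \<le> (\<integral>\<^sup>+x. \<integral>\<^sup>+y. ennreal ((u (fst (x, y)) - u (snd (x, y)))\<^sup>2) \<partial>m x \<partial>\<nu>)"
      by (intro nn_integral_mono order_trans[OF nn_integral_mono, of _ _ "\<lambda>x. \<integral>\<^sup>+y. ennreal ((u x - u y)\<^sup>2) \<partial>m x" ])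
         (auto simp: indicator_def power2_commute intro!: nn_integral_mono)
    also have "\<dots> = (\<integral>\<^sup>+p. ennreal ((u (fst p) - u (snd p))\<^sup>2) \<partial>edge_measure)"
      by (rule nn_integral_edge[symmetric]) simp
    also have "\<dots> = ennreal (dirichlet u u)"
      unfolding dirichlet_def power2_eq_square
      by (rule nn_integral_eq_integral[OF integrable_edge_gradient(1)[OF u u]]) simp
    also have "(\<integral>\<^sup>+x\<in>\<Omega>. ennreal (\<bar>u x\<bar>\<^sup>2) \<partial>\<nu>) = (\<integral>\<^sup>+x. ennreal ((u x)\<^sup>2) \<partial>\<nu>)"
      by (intro nn_integral_cong) (auto simp: indicator_def 0)
    also have "\<dots> = ennreal (\<integral>x. (u x)\<^sup>2 \<partial>\<nu>)"
      by (rule nn_integral_eq_integral[OF square_integrableD(2)[OF u]]) simp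
    finally show ?thesis
      using c by (simp add: ennreal_mult[symmetric] dirichlet_nonneg)
  qed
  then show ?thesis using c that by blast
qed

section \<open>Existence of the stress function\<close>

lemma measurable_nn_integral_kernel:
  assumes [measurable]: "f \<in> borel_measurable \<nu>"
  shows "(\<lambda>x. \<integral>\<^sup>+y. f y \<partial>m x) \<in> borel_measurable \<nu>"
  by (rule nn_integral_measurable_subprob_algebra2[where N = \<nu>]) auto

lemma laplacian_eq:
  assumes "x \<in> space \<nu>" and "integrable (m x) u"
  shows "laplacian u x = u x - (\<integral>y. u y \<partial>m x)"
proof -
  interpret prob_space "m x" by (rule prob_space_kernel[OF assms(1)])
  show ?thesis
    unfolding laplacian_def using assms(2) by (simp add: prob_space)
qed

text \<open>Partial sums of the Neumann series; probabilistically, the expected exit time from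
  \<open>\<Omega>\<close> truncated at \<open>n\<close>. Values in \<open>ennreal\<close> let
  integrals and suprema be formed before any finiteness is known.\<close>

primrec neumann :: "'a set \<Rightarrow> nat \<Rightarrow> 'a \<Rightarrow> ennreal" where
  "neumann \<Omega> 0 x = 0"
| "neumann \<Omega> (Suc n) x = indicator \<Omega> x * (1 + (\<integral>\<^sup>+y. neumann \<Omega> n y \<partial>m x))"

lemma neumann_measurable [measurable]:
  assumes [measurable]: "\<Omega> \<in> sets \<nu>"
  shows "neumann \<Omega> n \<in> borel_measurable \<nu>"
proof (induction n)
  case (Suc n)
  note [measurable] = measurable_nn_integral_kernel[OF Suc]
  have "(\<lambda>x. indicator \<Omega> x * (1 + (\<integral>\<^sup>+y. neumann \<Omega> n y \<partial>m x))) \<in> borel_measurable \<nu>"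
    by measurable
  then show ?case by simp
qed simp

lemma neumann_Suc_mono: "neumann \<Omega> n x \<le> neumann \<Omega> (Suc n) x"
proof (induction n arbitrary: x)
  case (Suc n)
  have "(\<integral>\<^sup>+y. neumann \<Omega> n y \<partial>m x) \<le> (\<integral>\<^sup>+y. neumann \<Omega> (Suc n) y \<partial>m x)"
    by (rule nn_integral_mono) (rule Suc)
  then show ?case
    by (simp only: neumann.simps(2)) (intro mult_left_mono add_left_mono; simp)
qed simp

lemma incseq_neumann: "incseq (neumann \<Omega>)"
  by (intro incseq_SucI le_funI neumann_Suc_mono)

text \<open>A crude bound, from \<open>m x\<close> having mass one. It only makes each single
  iterate finite and square integrable; the estimate uniform in \<open>n\<close> comes from the
  Poincare inequality.\<close>

lemma neumann_le: "x \<in> space \<nu> \<Longrightarrow> neumann \<Omega> n x \<le> of_nat n"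
proof (induction n arbitrary: x)
  case (Suc n)
  interpret prob_space "m x" by (rule prob_space_kernel[OF Suc.prems])
  have "(\<integral>\<^sup>+y. neumann \<Omega> n y \<partial>m x) \<le> (\<integral>\<^sup>+y. of_nat n \<partial>m x)"
    using Suc.prems by (intro nn_integral_mono Suc.IH) (simp add: space_kernel)
  also have "\<dots> = of_nat n" by (simp add: emeasure_space_1)
  finally show ?case
    by (auto simp: indicator_def add_left_mono)
qed simp

lemma neumann_eq_0: "x \<notin> \<Omega> \<Longrightarrow> neumann \<Omega> n x = 0"
  by (cases n) simp_all

text \<open>Dropping the first term of an increasing sequence keeps its supremum, and monotone
  convergence moves the supremum under the integral. Infinite values are still allowed here.\<close>

lemma neumann_fixed_point:
  assumes [measurable]: "\<Omega> \<in> sets \<nu>" and x: "x \<in> \<Omega>"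
  shows "(SUP n. neumann \<Omega> n x) = 1 + (\<integral>\<^sup>+y. (SUP n. neumann \<Omega> n y) \<partial>m x)"
proof -
  have xs: "x \<in> space \<nu>" using x sets.sets_into_space[OF assms(1)] by auto
  have "(SUP n. neumann \<Omega> n x) = (SUP n. neumann \<Omega> (Suc n) x)"
  proof (rule antisym)
    show "(SUP n. neumann \<Omega> n x) \<le> (SUP n. neumann \<Omega> (Suc n) x)"
      by (intro SUP_mono) (use neumann_Suc_mono in blast)
    show "(SUP n. neumann \<Omega> (Suc n) x) \<le> (SUP n. neumann \<Omega> n x)"
      by (intro SUP_mono) blast
  qed
  also have "\<dots> = (SUP n. 1 + (\<integral>\<^sup>+y. neumann \<Omega> n y \<partial>m x))"
    using x by simp
  also have "\<dots> = 1 + (SUP n. \<integral>\<^sup>+y. neumann \<Omega> n y \<partial>m x)"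
    by (rule ennreal_SUP_add_right[symmetric]) simp
  also have "(SUP n. \<integral>\<^sup>+y. neumann \<Omega> n y \<partial>m x) = (\<integral>\<^sup>+y. (SUP n. neumann \<Omega> n y) \<partial>m x)"
    by (rule nn_integral_monotone_convergence_SUP[symmetric, OF incseq_neumann])
       (simp add: measurable_kernel[OF xs])
  finally show ?thesis .
qed

text \<open>Each iterate is a subsolution: it is at most its successor, so its Laplacian is at most
  1 on \<open>\<Omega>\<close>. Testing with the iterate itself bounds its energy by twice its
  integral, and the Poincare inequality closes the estimate with a bound independent of
  \<open>n\<close>.\<close>

lemma neumann_L2_bound:
  assumes [measurable]: "\<Omega> \<in> sets \<nu>" and fin: "emeasure \<nu> \<Omega> < \<infinity>"
    and c: "0 < c" and P: "\<And>u. square_integrable u \<Longrightarrow> (\<And>x. x \<notin> \<Omega> \<Longrightarrow> u x = 0) \<Longrightarrow>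
      c * (\<integral>x. (u x)\<^sup>2 \<partial>\<nu>) \<le> dirichlet u u"
  shows "(\<integral>\<^sup>+x. (neumann \<Omega> n x)\<^sup>2 \<partial>\<nu>) \<le> ennreal (4 / c\<^sup>2 * measure \<nu> \<Omega>)"
proof -
  define r where "r x = enn2real (neumann \<Omega> n x)" for x
  have [measurable]: "r \<in> borel_measurable \<nu>" unfolding r_def by measurable
  have rn: "ennreal (r x) = neumann \<Omega> n x" if "x \<in> space \<nu>" for x
    unfolding r_def using neumann_le[OF that, of \<Omega> n] ennreal_of_nat_neq_top[of n]
    by (intro ennreal_enn2real) (metis less_top order_le_less_trans)
  have r0: "0 \<le> r x" for x by (simp add: r_def)
  have rle: "r x \<le> of_nat n" if "x \<in> space \<nu>" for x
    using neumann_le[OF that, of \<Omega> n] r0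
    by (simp flip: rn[OF that] add: ennreal_of_nat_eq_real_of_nat)
  have rz: "r x = 0" if "x \<notin> \<Omega>" for x using that by (simp add: r_def neumann_eq_0)
  have I\<Omega>: "integrable \<nu> (indicator \<Omega> :: 'a \<Rightarrow> real)" using fin by simp
  have bnd: "integrable \<nu> (\<lambda>x. indicator \<Omega> x * k :: real)" for k
    using I\<Omega> by auto
  have r1: "integrable \<nu> r"
    by (rule Bochner_Integration.integrable_bound[OF bnd[of "of_nat n"]])
       (auto intro!: AE_I2 simp: r0 rle rz indicator_def)
  have "integrable \<nu> (\<lambda>x. (r x)\<^sup>2)"
    by (rule Bochner_Integration.integrable_bound[OF bnd[of "(of_nat n)\<^sup>2"]])
       (auto intro!: AE_I2 power_mono simp: r0 rle rz indicator_def)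
  then have sq: "square_integrable r" by (simp add: square_integrable_def)
  have lap: "laplacian r x \<le> 1" if x: "x \<in> \<Omega>" for x
  proof -
    have xs: "x \<in> space \<nu>" using x sets.sets_into_space[OF assms(1)] by auto
    interpret prob_space "m x" by (rule prob_space_kernel[OF xs])
    have I: "integrable (m x) r"
      by (rule integrable_const_bound[of _ "of_nat n"])
         (auto intro!: AE_I2 simp: measurable_kernel[OF xs] space_kernel[OF xs] r0 rle)
    have "ennreal (r x) \<le> neumann \<Omega> (Suc n) x"
      using neumann_Suc_mono[of \<Omega> n x] by (simp only: rn[OF xs])
    also have "\<dots> = 1 + (\<integral>\<^sup>+y. ennreal (r y) \<partial>m x)"
      using x by (auto simp: space_kernel[OF xs] rn intro!: nn_integral_cong)
    also have "\<dots> = ennreal (1 + (\<integral>y. r y \<partial>m x))"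
      by (subst nn_integral_eq_integral[OF I]) (auto simp: r0 ennreal_plus integral_nonneg_AE)
    finally have "r x \<le> 1 + (\<integral>y. r y \<partial>m x)"
      by (subst (asm) ennreal_le_iff) (auto simp: r0 intro!: add_nonneg_nonneg integral_nonneg_AE)
    then show ?thesis by (simp add: laplacian_eq[OF xs I])
  qed
  have "c * (\<integral>x. (r x)\<^sup>2 \<partial>\<nu>) \<le> dirichlet r r"
    by (rule P[OF sq rz])
  also have "\<dots> = 2 * (\<integral>x. r x * laplacian r x \<partial>\<nu>)"
    by (rule Green_formula(2)[OF sq sq])
  also have "(\<integral>x. r x * laplacian r x \<partial>\<nu>) \<le> (\<integral>x. r x \<partial>\<nu>)"
  proof (rule integral_mono[OF Green_formula(1)[OF sq sq] r1])
    show "r x * laplacian r x \<le> r x" for x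
      using mult_left_mono[OF lap r0, of x x] by (cases "x \<in> \<Omega>") (auto simp: rz)
  qed
  also have "2 * (\<integral>x. r x \<partial>\<nu>) = (\<integral>x. 2 * r x \<partial>\<nu>)" by simp
  \<comment> \<open>Young's inequality, weighted so that half of the left-hand side
    \<open>c * (\<integral>x. (r x)\<^sup>2 \<partial>\<nu>)\<close> absorbs the quadratic
    term.\<close>
  also have "\<dots> \<le> (\<integral>x. c / 2 * (r x)\<^sup>2 + 2 / c * indicator \<Omega> x \<partial>\<nu>)"
  proof (rule integral_mono)
    fix x
    have "0 \<le> (c * r x - 2)\<^sup>2 / (2 * c)" using c by simp
    also have "\<dots> = c / 2 * (r x)\<^sup>2 + 2 / c - 2 * r x"
      using c by (simp add: field_simps power2_eq_square)
    finally show "2 * r x \<le> c / 2 * (r x)\<^sup>2 + 2 / c * indicator \<Omega> x"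
      by (cases "x \<in> \<Omega>") (auto simp: rz)
  qed (use r1 sq I\<Omega> in \<open>auto simp: square_integrable_def\<close>)
  also have "\<dots> = c / 2 * (\<integral>x. (r x)\<^sup>2 \<partial>\<nu>) + 2 / c * measure \<nu> \<Omega>"
    using sq I\<Omega> by (subst Bochner_Integration.integral_add) (auto simp: square_integrable_def)
  finally have "(\<integral>x. (r x)\<^sup>2 \<partial>\<nu>) \<le> 4 / c\<^sup>2 * measure \<nu> \<Omega>"
    using c by (simp add: field_simps power2_eq_square)
  moreover have "(\<integral>\<^sup>+x. (neumann \<Omega> n x)\<^sup>2 \<partial>\<nu>) = (\<integral>\<^sup>+x. ennreal ((r x)\<^sup>2) \<partial>\<nu>)"
    by (intro nn_integral_cong) (simp flip: rn add: ennreal_power r0)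
  moreover have "\<dots> = ennreal (\<integral>x. (r x)\<^sup>2 \<partial>\<nu>)"
    by (rule nn_integral_eq_integral[OF square_integrableD(2)[OF sq]]) simp
  ultimately show ?thesis
    by (simp add: ennreal_leI)
qed

text \<open>
  The Neumann series of \<open>u = 1 + K u\<close>, where \<open>K\<close> is averaging over one step restricted to \<open>\<Omega>\<close>,
  is monotone, so existence needs only the uniform \<open>L\<^sup>2\<close> bound and no Hilbert space theory.
\<close>

lemma stress_function_exists:
  assumes [measurable]: "\<Omega> \<in> sets \<nu>" and fin: "emeasure \<nu> \<Omega> < \<infinity>" and poin: "poincare_2 m \<nu> \<Omega>"
  shows "\<exists>f. is_m_stress_function m \<nu> \<Omega> f"
proof -
  obtain c where c: "0 < c" and P: "\<And>u. square_integrable u \<Longrightarrow> (\<And>x. x \<notin> \<Omega> \<Longrightarrow> u x = 0) \<Longrightarrow>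
      c * (\<integral>x. (u x)\<^sup>2 \<partial>\<nu>) \<le> dirichlet u u"
    using poincare_dirichlet[OF assms(1) poin] by blast
  define g where "g x = (SUP n. neumann \<Omega> n x)" for x
  have [measurable]: "g \<in> borel_measurable \<nu>"
    unfolding g_def by measurable
  \<comment> \<open>\<open>enn2real\<close> sends infinity to 0; by \<open>gfin\<close> below this
    alters \<open>g\<close> only on a null set.\<close>
  define u where "u x = enn2real (g x)" for x
  have [measurable]: "u \<in> borel_measurable \<nu>" unfolding u_def by measurable
  have uz: "u x = 0" if "x \<notin> \<Omega>" for x
    using that by (simp add: u_def g_def neumann_eq_0)
  have unn: "0 \<le> u x" for x by (simp add: u_def)
  have "(\<integral>\<^sup>+x. (g x)\<^sup>2 \<partial>\<nu>) \<le> (\<integral>\<^sup>+x. (SUP n. (neumann \<Omega> n x)\<^sup>2) \<partial>\<nu>)"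
    unfolding g_def using incseq_neumann
    by (intro nn_integral_mono ennreal_SUP_square) (auto simp: incseq_def le_fun_def)
  also have "\<dots> = (SUP n. \<integral>\<^sup>+x. (neumann \<Omega> n x)\<^sup>2 \<partial>\<nu>)"
    using incseq_neumann
    by (intro nn_integral_monotone_convergence_SUP) (auto simp: incseq_def le_fun_def intro!: power_mono)
  also have "\<dots> \<le> ennreal (4 / c\<^sup>2 * measure \<nu> \<Omega>)"
    by (intro SUP_least neumann_L2_bound[OF assms(1) fin c P])
  finally have L2: "(\<integral>\<^sup>+x. (g x)\<^sup>2 \<partial>\<nu>) < \<infinity>"
    by (auto simp: less_top[symmetric] top_unique)
  then have "AE x in \<nu>. (g x)\<^sup>2 \<noteq> \<infinity>"
    by (intro nn_integral_PInf_AE) auto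
  then have gfin: "AE x in \<nu>. g x < \<infinity>"
    by eventually_elim (auto simp: power2_eq_square less_top[symmetric] ennreal_top_mult)
  have u2: "integrable \<nu> (\<lambda>x. (u x)\<^sup>2)"
  proof (rule integrableI_bounded)
    have "(\<integral>\<^sup>+x. ennreal (norm ((u x)\<^sup>2)) \<partial>\<nu>) = (\<integral>\<^sup>+x. (g x)\<^sup>2 \<partial>\<nu>)"
    proof (rule nn_integral_cong_AE)
      show "AE x in \<nu>. ennreal (norm ((u x)\<^sup>2)) = (g x)\<^sup>2"
        using gfin by eventually_elim (simp add: u_def flip: ennreal_power)
    qed
    then show "(\<integral>\<^sup>+x. ennreal (norm ((u x)\<^sup>2)) \<partial>\<nu>) < \<infinity>" using L2 by simp
  qed simp
  have lap: "AE x in \<nu>. x \<in> \<Omega> \<longrightarrow> laplacian u x = 1"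
    \<comment> \<open>Finiteness of \<open>g\<close> is needed at \<open>x\<close> and also at
      \<open>m x\<close>-almost every \<open>y\<close>, so that \<open>u\<close> may replace
      \<open>g\<close> under the integral.\<close>
    using gfin AE_kernel[OF gfin]
  proof eventually_elim
    case (elim x)
    show ?case
    proof
      assume x: "x \<in> \<Omega>"
      have xs: "x \<in> space \<nu>" using x sets.sets_into_space[OF assms(1)] by auto
      have gx: "g x = 1 + (\<integral>\<^sup>+y. g y \<partial>m x)"
        unfolding g_def by (rule neumann_fixed_point[OF assms(1) x])
      have "(\<integral>\<^sup>+y. ennreal (u y) \<partial>m x) = (\<integral>\<^sup>+y. g y \<partial>m x)"
      proof (rule nn_integral_cong_AE)
        show "AE y in m x. ennreal (u y) = g y"
          using elim(2) by eventually_elim (simp add: u_def)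
      qed
      then have gx': "g x = 1 + (\<integral>\<^sup>+y. ennreal (u y) \<partial>m x)" using gx by simp
      \<comment> \<open>The integral is a summand of the finite value \<open>g x\<close>, which
        gives integrability without a separate estimate.\<close>
      then have fin: "(\<integral>\<^sup>+y. ennreal (u y) \<partial>m x) < \<infinity>"
        using elim(1) by auto
      have I: "integrable (m x) u"
        by (rule integrableI_nonneg) (use fin in \<open>auto simp: measurable_kernel[OF xs] u_def\<close>)
      have "u x = 1 + (\<integral>y. u y \<partial>m x)"
      proof -
        have "ennreal (u x) = 1 + ennreal (\<integral>y. u y \<partial>m x)"
          using gx' elim(1) nn_integral_eq_integral[OF I] unn by (simp add: u_def[of x])
        also have "\<dots> = ennreal (1 + (\<integral>y. u y \<partial>m x))"
          by (subst ennreal_plus) (auto simp: unn intro!: integral_nonneg_AE)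
        finally have "ennreal (u x) = ennreal (1 + (\<integral>y. u y \<partial>m x))" .
        then show ?thesis
          by (subst (asm) ennreal_inj) (auto simp: unn intro!: add_nonneg_nonneg integral_nonneg_AE)
      qed
      then show "laplacian u x = 1" by (simp add: laplacian_eq[OF xs I])
    qed
  qed
  have L2u: "L2_on \<nu> (m_closure m \<nu> \<Omega>) u"
    unfolding L2_on_def set_borel_measurable_def set_integrable_def
    using integrable_mult_indicator[OF sets_m_closure[OF assms(1)] u2] by auto
  have u0: "AE x in \<nu>. x \<in> m_boundary m \<nu> \<Omega> \<longrightarrow> u x = 0"
    by (auto intro!: AE_I2 uz simp: m_boundary_def)
  have eq: "(\<lambda>x. indicator \<Omega> x * u x) = u"
  proof (rule ext)
    show "indicator \<Omega> x * u x = u x" for x by (cases "x \<in> \<Omega>") (simp_all add: uz)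
  qed
  have "AE x in \<nu>. x \<in> \<Omega> \<longrightarrow> - (LINT y:m_closure m \<nu> \<Omega>|m x. u y - u x) = 1"
    using set_integral_closure_eq_laplacian[OF assms(1) L2u u0] lap
    unfolding eq by eventually_elim simp
  then show ?thesis
    using L2u u0 unfolding is_m_stress_function_def by blast
qed

section \<open>Bounds for the torsional rigidity\<close>

text \<open>The perimeter is the mass of the steps leaving \<open>E\<close>. The complement may be
  taken in the whole type because \<open>m x\<close> lives on \<open>space \<nu>\<close>.\<close>

lemma m_perimeter_edge:
  assumes [measurable]: "E \<in> sets \<nu>"
  shows "m_perimeter m \<nu> E = (\<integral>\<^sup>+p. indicator E (fst p) * indicator (- E) (snd p) \<partial>edge_measure)"
proof -
  have "(\<integral>\<^sup>+y. indicator E x * indicator (- E) y \<partial>m x) = emeasure (m x) (space \<nu> - E) * indicator E x"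
    if x: "x \<in> space \<nu>" for x
  proof -
    have [measurable]: "E \<in> sets (m x)" by (simp add: sets_kernel[OF x])
    have "(\<integral>\<^sup>+y. indicator E x * indicator (- E) y \<partial>m x) =
        (\<integral>\<^sup>+y. indicator E x * indicator (space (m x) - E) y \<partial>m x)"
      by (intro nn_integral_cong) (auto simp: indicator_def)
    also have "\<dots> = indicator E x * emeasure (m x) (space (m x) - E)"
      by (subst nn_integral_cmult_indicator) auto
    finally show ?thesis by (simp add: space_kernel[OF x] mult.commute)
  qed
  then show ?thesis
    unfolding m_perimeter_def m_interaction_def
    by (subst nn_integral_edge) (auto intro!: nn_integral_cong)
qed

lemma square_integrable_indicator:
  assumes "E \<in> sets \<nu>" "emeasure \<nu> E < \<infinity>"
  shows "square_integrable (indicator E)"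
proof -
  have "(\<lambda>x. (indicator E x :: real)\<^sup>2) = indicator E"
    by (auto simp: indicator_def)
  then show ?thesis
    using assms by (simp add: square_integrable_def)
qed

text \<open>The squared gradient of the indicator is 1 exactly on the steps that enter or leave
  \<open>E\<close>, and by reversibility these two kinds have equal mass. In particular the
  perimeter is finite.\<close>

lemma dirichlet_indicator:
  assumes [measurable]: "E \<in> sets \<nu>" and fin: "emeasure \<nu> E < \<infinity>"
  shows "m_perimeter m \<nu> E = ennreal (dirichlet (indicator E) (indicator E) / 2)"
proof -
  let ?F = "\<lambda>p. indicator E (fst p) * indicator (- E) (snd p) :: ennreal"
  have "2 * m_perimeter m \<nu> E = (\<integral>\<^sup>+p. ?F p \<partial>edge_measure) + (\<integral>\<^sup>+p. ?F (snd p, fst p) \<partial>edge_measure)"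
    by (subst nn_integral_edge_swap) (simp_all add: m_perimeter_edge mult_2)
  also have "\<dots> = (\<integral>\<^sup>+p. ?F p + ?F (snd p, fst p) \<partial>edge_measure)"
    by (rule nn_integral_add[symmetric]) simp_all
  also have "\<dots> = (\<integral>\<^sup>+p. ennreal ((indicator E (fst p) - indicator E (snd p)) *
      (indicator E (fst p) - indicator E (snd p))) \<partial>edge_measure)"
    by (intro nn_integral_cong) (auto simp: indicator_def)
  also have "\<dots> = ennreal (dirichlet (indicator E) (indicator E))"
    unfolding dirichlet_def
    using integrable_edge_gradient(1)[OF square_integrable_indicator square_integrable_indicator, OF assms assms]
    by (intro nn_integral_eq_integral) auto
  finally have "2 * m_perimeter m \<nu> E = 2 * ennreal (dirichlet (indicator E) (indicator E) / 2)"
    by (simp add: ennreal_mult[symmetric, of 2, simplified] dirichlet_nonneg)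
  then show ?thesis
    by (simp add: ennreal_mult_cancel_left)
qed

section \<open>Quadratic expansion of the form and testing the stress equation\<close>

lemma square_integrable_diff_scaled:
  assumes u: "square_integrable u" and v: "square_integrable v"
  shows "square_integrable (\<lambda>x. u x - t * v x)"
proof -
  note [measurable] = square_integrableD(1)[OF u] square_integrableD(1)[OF v]
  have "integrable \<nu> (\<lambda>x. 2 * (u x)\<^sup>2 + 2 * t\<^sup>2 * (v x)\<^sup>2)"
    using square_integrableD(2)[OF u] square_integrableD(2)[OF v] by auto
  moreover have "(u x - t * v x)\<^sup>2 \<le> 2 * (u x)\<^sup>2 + 2 * t\<^sup>2 * (v x)\<^sup>2" for x
    using zero_le_power2[of "u x + t * v x"] by (simp add: power2_eq_square algebra_simps)
  ultimately have "integrable \<nu> (\<lambda>x. (u x - t * v x)\<^sup>2)"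
    by (elim Bochner_Integration.integrable_bound) (auto intro!: AE_I2 simp: abs_of_nonneg)
  then show ?thesis by (simp add: square_integrable_def)
qed

lemma dirichlet_diff_scaled:
  assumes u: "square_integrable u" and v: "square_integrable v"
  shows "dirichlet (\<lambda>x. u x - t * v x) (\<lambda>x. u x - t * v x) =
    dirichlet u u - 2 * t * dirichlet u v + t\<^sup>2 * dirichlet v v"
proof -
  note uu = integrable_edge_gradient(1)[OF u u] and uv = integrable_edge_gradient(1)[OF u v]
    and vv = integrable_edge_gradient(1)[OF v v]
  have "dirichlet (\<lambda>x. u x - t * v x) (\<lambda>x. u x - t * v x) =
      (\<integral>p. (u (fst p) - u (snd p)) * (u (fst p) - u (snd p))
        - 2 * t * ((u (fst p) - u (snd p)) * (v (fst p) - v (snd p)))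
        + t\<^sup>2 * ((v (fst p) - v (snd p)) * (v (fst p) - v (snd p))) \<partial>edge_measure)"
    unfolding dirichlet_def
    by (intro Bochner_Integration.integral_cong) (auto simp: power2_eq_square algebra_simps)
  also have "\<dots> = dirichlet u u - 2 * t * dirichlet u v + t\<^sup>2 * dirichlet v v"
    using uu uv vv unfolding dirichlet_def
    by (subst Bochner_Integration.integral_add) auto
  finally show ?thesis .
qed

text \<open>In the Green formula the Laplacian of \<open>u\<close> is weighted by \<open>v\<close>,
  hence only seen on \<open>\<Omega>\<close>, where it is 1.\<close>

lemma dirichlet_stress:
  assumes u: "square_integrable u" and lap: "AE x in \<nu>. x \<in> \<Omega> \<longrightarrow> laplacian u x = 1"
    and v: "square_integrable v" and 0: "\<And>x. x \<notin> \<Omega> \<Longrightarrow> v x = 0"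
  shows "dirichlet u v = 2 * (\<integral>x. v x \<partial>\<nu>)"
proof -
  have "AE x in \<nu>. v x * laplacian u x = v x"
    using lap by eventually_elim (metis 0 mult_zero_left mult.right_neutral)
  then have "(\<integral>x. v x * laplacian u x \<partial>\<nu>) = (\<integral>x. v x \<partial>\<nu>)"
    using borel_measurable_integrable[OF Green_formula(1)[OF u v]] square_integrableD(1)[OF v]
    by (intro integral_cong_AE)
  then show ?thesis
    by (simp add: Green_formula(2)[OF u v])
qed

text \<open>Coarea: integrate the isoperimetric inequality over the superlevel sets of \<open>w\<close>.\<close>

lemma isoperimetric_imp_Sobolev:
  fixes h :: ennreal
  assumes [measurable]: "w \<in> borel_measurable \<nu>" and pos: "\<And>x. 0 \<le> w x"
    and 0: "\<And>x. x \<notin> \<Omega> \<Longrightarrow> w x = 0"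
    and iso: "\<And>E. E \<in> sets \<nu> \<Longrightarrow> E \<subseteq> \<Omega> \<Longrightarrow> h * emeasure \<nu> E \<le> m_perimeter m \<nu> E"
  shows "h * (\<integral>\<^sup>+x. ennreal (w x) \<partial>\<nu>) \<le> (\<integral>\<^sup>+p. ennreal (w (fst p) - w (snd p)) \<partial>edge_measure)"
proof -
  interpret L: pair_sigma_finite lborel \<nu> by unfold_locales
  interpret edge: sigma_finite_measure edge_measure by (rule sigma_finite_edge)
  interpret M: pair_sigma_finite lborel edge_measure by unfold_locales
  \<comment> \<open>\<open>?F\<close> marks the points of the superlevel set of height
    \<open>t\<close>, \<open>?G\<close> the steps that leave it.\<close>
  let ?F = "\<lambda>(t::real, x). if 0 \<le> t \<and> t < w x then 1 else 0 :: ennreal"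
  let ?G = "\<lambda>(t::real, p). if 0 \<le> t \<and> t < w (fst p) \<and> w (snd p) \<le> t then 1 else 0 :: ennreal"
  have [measurable]: "?F \<in> borel_measurable (lborel \<Otimes>\<^sub>M \<nu>)" by measurable
  have [measurable]: "?G \<in> borel_measurable (lborel \<Otimes>\<^sub>M edge_measure)" by measurable
  have layer: "h * (\<integral>\<^sup>+x. ?F (t, x) \<partial>\<nu>) \<le> (\<integral>\<^sup>+p. ?G (t, p) \<partial>edge_measure)" for t
  proof (cases "0 \<le> t")
    case True
    let ?E = "{x \<in> space \<nu>. t < w x}"
    have E: "?E \<in> sets \<nu>" by measurable
    have "(\<integral>\<^sup>+x. ?F (t, x) \<partial>\<nu>) = (\<integral>\<^sup>+x. indicator ?E x \<partial>\<nu>)"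
      using True by (intro nn_integral_cong) auto
    then have "h * (\<integral>\<^sup>+x. ?F (t, x) \<partial>\<nu>) = h * emeasure \<nu> ?E"
      using E by simp
    also have "\<dots> \<le> m_perimeter m \<nu> ?E"
      \<comment> \<open>For \<open>t \<ge> 0\<close> the superlevel set lies in
        \<open>\<Omega>\<close>, since \<open>w\<close> vanishes elsewhere.\<close>
      using E 0 True by (intro iso) (auto intro: ccontr)
    also have "\<dots> = (\<integral>\<^sup>+p. ?G (t, p) \<partial>edge_measure)"
      unfolding m_perimeter_edge[OF E] using True
      by (intro nn_integral_cong) (auto simp: indicator_def)
    finally show ?thesis .
  qed (simp add: case_prod_beta)
  have "(\<integral>\<^sup>+x. ennreal (w x) \<partial>\<nu>) = (\<integral>\<^sup>+x. \<integral>\<^sup>+t. ?F (t, x) \<partial>lborel \<partial>\<nu>)"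
  proof (rule nn_integral_cong)
    fix x
    have "(\<integral>\<^sup>+t. ?F (t, x) \<partial>lborel) = (\<integral>\<^sup>+t. indicator {0..<w x} t \<partial>lborel)"
      by (intro nn_integral_cong) (auto simp: indicator_def)
    then show "ennreal (w x) = (\<integral>\<^sup>+t. ?F (t, x) \<partial>lborel)"
      using pos by simp
  qed
  also have "\<dots> = (\<integral>\<^sup>+t. \<integral>\<^sup>+x. ?F (t, x) \<partial>\<nu> \<partial>lborel)"
    by (rule L.Fubini') measurable
  finally have "h * (\<integral>\<^sup>+x. ennreal (w x) \<partial>\<nu>) = (\<integral>\<^sup>+t. h * (\<integral>\<^sup>+x. ?F (t, x) \<partial>\<nu>) \<partial>lborel)"
    by (simp only:) (rule nn_integral_cmult[symmetric], measurable)
  also have "\<dots> \<le> (\<integral>\<^sup>+t. \<integral>\<^sup>+p. ?G (t, p) \<partial>edge_measure \<partial>lborel)"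
    by (rule nn_integral_mono) (rule layer)
  also have "\<dots> = (\<integral>\<^sup>+p. \<integral>\<^sup>+t. ?G (t, p) \<partial>lborel \<partial>edge_measure)"
    by (rule M.Fubini'[symmetric]) measurable
  also have "\<dots> = (\<integral>\<^sup>+p. ennreal (w (fst p) - w (snd p)) \<partial>edge_measure)"
  proof (rule nn_integral_cong)
    fix p
    \<comment> \<open>The step leaves exactly the levels in this interval. Its length is the
      positive part of the drop, which is what \<open>ennreal\<close> of the difference
      denotes.\<close>
    have "(\<integral>\<^sup>+t. ?G (t, p) \<partial>lborel) = (\<integral>\<^sup>+t. indicator {w (snd p)..<w (fst p)} t \<partial>lborel)"
      by (intro nn_integral_cong) (use pos[of "snd p"] in \<open>auto simp: indicator_def\<close>)
    also have "\<dots> = ennreal (w (fst p) - w (snd p))"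
      by (cases "w (snd p) \<le> w (fst p)") (auto simp: ennreal_neg)
    finally show "(\<integral>\<^sup>+t. ?G (t, p) \<partial>lborel) = ennreal (w (fst p) - w (snd p))" .
  qed
  finally show ?thesis .
qed

lemma integrable_finite_support:
  assumes [measurable]: "\<Omega> \<in> sets \<nu>" and fin: "emeasure \<nu> \<Omega> < \<infinity>"
    and u: "square_integrable u" and 0: "\<And>x. x \<notin> \<Omega> \<Longrightarrow> u x = 0"
  shows "integrable \<nu> u"
proof -
  note [measurable] = square_integrableD(1)[OF u]
  have "integrable \<nu> (\<lambda>x. (u x)\<^sup>2 + indicator \<Omega> x)"
    using square_integrableD(2)[OF u] fin by (intro Bochner_Integration.integrable_add) auto
  then show ?thesis
  proof (rule Bochner_Integration.integrable_bound)
    show "AE x in \<nu>. norm (u x) \<le> norm ((u x)\<^sup>2 + indicator \<Omega> x)"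
    proof (rule AE_I2)
      fix x show "norm (u x) \<le> norm ((u x)\<^sup>2 + indicator \<Omega> x)"
        using abs_mult_le_sum_squares[of "u x" 1] 0[of x] by (cases "x \<in> \<Omega>") (auto simp: abs_of_nonneg)
    qed
  qed simp
qed

lemma torsion_lower_bound:
  assumes [measurable]: "\<Omega> \<in> sets \<nu>" and fin: "emeasure \<nu> \<Omega> < \<infinity>"
    and u: "square_integrable u" and 0: "\<And>x. x \<notin> \<Omega> \<Longrightarrow> u x = 0"
    and lap: "AE x in \<nu>. x \<in> \<Omega> \<longrightarrow> laplacian u x = 1"
    and p: "p = dirichlet (indicator \<Omega>) (indicator \<Omega>) / 2" "0 < p"
  shows "(measure \<nu> \<Omega>)\<^sup>2 / p \<le> (\<integral>x. u x \<partial>\<nu>)"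
proof -
  \<comment> \<open>The energy of \<open>u - t * indicator \<Omega>\<close> is
    \<open>2 * ?T - 4 * t * ?V + 2 * p * t\<^sup>2\<close>, and \<open>?t\<close> is its minimiser;
    nonnegativity there is the Cauchy-Schwarz inequality.\<close>
  let ?V = "measure \<nu> \<Omega>" and ?T = "\<integral>x. u x \<partial>\<nu>" and ?t = "measure \<nu> \<Omega> / p"
  note ind = square_integrable_indicator[OF assms(1) fin]
  have "0 \<le> dirichlet (\<lambda>x. u x - ?t * indicator \<Omega> x) (\<lambda>x. u x - ?t * indicator \<Omega> x)"
    by (rule dirichlet_nonneg)
  also have "\<dots> = dirichlet u u - 2 * ?t * dirichlet u (indicator \<Omega>)
      + ?t\<^sup>2 * dirichlet (indicator \<Omega>) (indicator \<Omega>)"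
    by (rule dirichlet_diff_scaled[OF u ind])
  also have "dirichlet u u = 2 * ?T"
    by (rule dirichlet_stress[OF u lap u 0])
  also have "dirichlet u (indicator \<Omega>) = 2 * ?V"
    using dirichlet_stress[OF u lap ind] by simp
  also have "dirichlet (indicator \<Omega>) (indicator \<Omega>) = 2 * p"
    using p by simp
  also have "2 * ?T - 2 * ?t * (2 * ?V) + ?t\<^sup>2 * (2 * p) = 2 * (?T - ?V\<^sup>2 / p)"
    using p(2) by (simp add: field_simps power2_eq_square)
  finally show ?thesis by simp
qed

lemma torsion_upper_bound:
  assumes [measurable]: "\<Omega> \<in> sets \<nu>" and fin: "emeasure \<nu> (m_closure m \<nu> \<Omega>) < \<infinity>"
    and u: "square_integrable u" and 0: "\<And>x. x \<notin> \<Omega> \<Longrightarrow> u x = 0"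
    and lap: "AE x in \<nu>. x \<in> \<Omega> \<longrightarrow> laplacian u x = 1"
    and h: "0 < h" and iso: "\<And>E. E \<in> sets \<nu> \<Longrightarrow> E \<subseteq> \<Omega> \<Longrightarrow>
      ennreal h * emeasure \<nu> E \<le> m_perimeter m \<nu> E"
  shows "(\<integral>x. u x \<partial>\<nu>) \<le> measure \<nu> (m_closure m \<nu> \<Omega>) / (2 * h\<^sup>2)"
proof -
  let ?C = "m_closure m \<nu> \<Omega>" and ?T = "\<integral>x. u x \<partial>\<nu>"
  note [measurable] = square_integrableD(1)[OF u]
  have "emeasure \<nu> \<Omega> \<le> emeasure \<nu> ?C"
    by (rule emeasure_mono) (auto simp: m_closure_def intro: sets_m_closure[unfolded m_closure_def])
  then have "emeasure \<nu> \<Omega> < \<infinity>" using fin by (rule order_le_less_trans)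
  then have u1: "integrable \<nu> u"
    by (rule integrable_finite_support[OF assms(1) _ u 0])
  \<comment> \<open>The coarea lemma asks for a nonnegative function;
    \<open>u \<le> \<bar>u\<bar>\<close> brings back the integral of \<open>u\<close> at the
    end.\<close>
  define w where "w x = \<bar>u x\<bar>" for x
  have [measurable]: "w \<in> borel_measurable \<nu>" unfolding w_def by measurable
  have w1: "integrable \<nu> w" unfolding w_def using u1 by (rule integrable_abs)
  let ?D = "\<lambda>p. ennreal (w (fst p) - w (snd p))"
  have eu: "dirichlet u u = 2 * ?T" by (rule dirichlet_stress[OF u lap u 0])
  have IC: "integrable \<nu> (indicator ?C :: 'a \<Rightarrow> real)"
    using fin by simp
  \<comment> \<open>Young's bound for the absolute gradient. The weight \<open>h / 2\<close> makes
    the energy term integrate to \<open>h * ?T\<close>, half of what the coarea inequality must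
    absorb. The constant term is charged only to steps starting in the closure, and the first
    marginal turns it into the measure of the closure.\<close>
  define B where "B p = h / 2 * ((u (fst p) - u (snd p)) * (u (fst p) - u (snd p)))
    + 1 / (2 * h) * indicator ?C (fst p)" for p
  have IB: "integrable edge_measure (\<lambda>p. indicator ?C (fst p) :: real)"
    using IC by (subst integrable_edge_fst) auto
  have B: "integrable edge_measure B"
    unfolding B_def using integrable_edge_gradient(1)[OF u u] IB by auto
  have intB: "(\<integral>p. B p \<partial>edge_measure) = h * ?T + measure \<nu> ?C / (2 * h)"
  proof -
    have "(\<integral>p. B p \<partial>edge_measure) = h / 2 * dirichlet u u + 1 / (2 * h) * (\<integral>p. indicator ?C (fst p) \<partial>edge_measure)"
      unfolding B_def dirichlet_def using integrable_edge_gradient(1)[OF u u] IB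
      by (subst Bochner_Integration.integral_add) auto
    also have "(\<integral>p. indicator ?C (fst p) \<partial>edge_measure) = measure \<nu> ?C"
      by (subst integral_edge_fst) auto
    finally show ?thesis by (simp add: eu)
  qed
  have B0: "0 \<le> B p" for p
    using h by (simp add: B_def)
  have le: "AE p in edge_measure. \<bar>w (fst p) - w (snd p)\<bar> \<le> B p"
    using AE_edge_closure(2)[OF assms(1)]
  proof eventually_elim
    case (elim p)
    let ?d = "u (fst p) - u (snd p)"
    have wd: "\<bar>w (fst p) - w (snd p)\<bar> \<le> \<bar>?d\<bar>" by (simp add: w_def)
    show ?case
    proof (cases "fst p \<in> ?C")
      case True
      have "0 \<le> (h * \<bar>?d\<bar> - 1)\<^sup>2 / (2 * h)" using h by simp
      also have "\<dots> = h / 2 * (\<bar>?d\<bar> * \<bar>?d\<bar>) + 1 / (2 * h) - \<bar>?d\<bar>"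
        using h by (simp add: field_simps power2_eq_square del: abs_mult_self_eq)
      finally show ?thesis using wd True by (simp add: B_def)
    next
      case False
      \<comment> \<open>Almost every step that starts outside the closure also misses
        \<open>\<Omega>\<close> at its end, so \<open>u\<close> vanishes at both points and both
        sides are 0.\<close>
      then have "fst p \<notin> \<Omega>" "snd p \<notin> \<Omega>" using elim by (auto simp: m_closure_def)
      then show ?thesis by (simp add: B_def w_def 0 False)
    qed
  qed
  \<comment> \<open>Doubling and exchanging coordinates in one copy turns the positive part of the
    drop into its absolute value.\<close>
  have "2 * (ennreal h * (\<integral>\<^sup>+x. ennreal (w x) \<partial>\<nu>)) \<le> 2 * (\<integral>\<^sup>+p. ?D p \<partial>edge_measure)"
    by (intro mult_left_mono isoperimetric_imp_Sobolev[of w \<Omega>] iso) (auto simp: w_def 0)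
  also have "\<dots> = (\<integral>\<^sup>+p. ?D p \<partial>edge_measure) + (\<integral>\<^sup>+p. ?D (snd p, fst p) \<partial>edge_measure)"
    by (subst nn_integral_edge_swap) (simp_all add: mult_2)
  also have "\<dots> = (\<integral>\<^sup>+p. ?D p + ?D (snd p, fst p) \<partial>edge_measure)"
    by (rule nn_integral_add[symmetric]) simp_all
  also have "\<dots> \<le> (\<integral>\<^sup>+p. ennreal (B p) \<partial>edge_measure)"
  proof (rule nn_integral_mono_AE)
    show "AE p in edge_measure. ?D p + ?D (snd p, fst p) \<le> ennreal (B p)"
      using le
    proof eventually_elim
      case (elim p)
      have "?D p + ?D (snd p, fst p) = ennreal \<bar>w (fst p) - w (snd p)\<bar>"
        by (cases "w (snd p) \<le> w (fst p)") (auto simp: ennreal_neg)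
      then show ?case using elim by (simp add: ennreal_leI)
    qed
  qed
  also have "\<dots> = ennreal (h * ?T + measure \<nu> ?C / (2 * h))"
    by (subst nn_integral_eq_integral[OF B]) (simp_all add: B0 intB)
  also have "(\<integral>\<^sup>+x. ennreal (w x) \<partial>\<nu>) = ennreal (\<integral>x. w x \<partial>\<nu>)"
    by (rule nn_integral_eq_integral[OF w1]) (simp add: w_def)
  also have "2 * (ennreal h * ennreal (\<integral>x. w x \<partial>\<nu>)) = ennreal (2 * (h * (\<integral>x. w x \<partial>\<nu>)))"
    using h by (simp add: ennreal_mult' w_def)
  finally have "2 * (h * (\<integral>x. w x \<partial>\<nu>)) \<le> h * ?T + measure \<nu> ?C / (2 * h)"
    using dirichlet_nonneg[of u] h by (subst (asm) ennreal_le_iff) (auto simp: eu)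
  moreover have "?T \<le> (\<integral>x. w x \<partial>\<nu>)"
    by (rule integral_mono[OF u1 w1]) (simp add: w_def)
  then have "h * ?T \<le> h * (\<integral>x. w x \<partial>\<nu>)" using h by simp
  ultimately have "h * ?T \<le> measure \<nu> ?C / (2 * h)" by linarith
  then show ?thesis
    using h by (simp add: field_simps power2_eq_square)
qed

end

text \<open>Calibrability makes the quotient of \<open>\<Omega>\<close> the infimum over all
  admissible \<open>E\<close>. Clearing the denominator in \<open>ennreal\<close> takes
  \<open>E\<close> of positive finite measure; for null \<open>E\<close> the left-hand side is
  0.\<close>

lemma m_calibrable_isoperimetric:
  assumes cal: "m_calibrable m \<nu> \<Omega>" and E: "E \<in> sets \<nu>" "E \<subseteq> \<Omega>" and \<Omega>: "\<Omega> \<in> sets \<nu>"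
    and fin: "emeasure \<nu> \<Omega> < \<infinity>"
  shows "m_perimeter m \<nu> \<Omega> / emeasure \<nu> \<Omega> * emeasure \<nu> E \<le> m_perimeter m \<nu> E"
proof (cases "emeasure \<nu> E = 0")
  case False
  have "emeasure \<nu> E \<noteq> \<top>"
    using emeasure_mono[OF E(2) \<Omega>] fin by (auto simp: top_unique)
  have "m_perimeter m \<nu> \<Omega> / emeasure \<nu> \<Omega> \<le> m_perimeter m \<nu> E / emeasure \<nu> E"
    unfolding cal[unfolded m_calibrable_def m_cheeger_constant_def, symmetric]
    using E False by (intro INF_lower) (auto simp: zero_less_iff_neq_zero)
  then have "m_perimeter m \<nu> \<Omega> / emeasure \<nu> \<Omega> * emeasure \<nu> E \<le> m_perimeter m \<nu> E / emeasure \<nu> E * emeasure \<nu> E"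
    by (rule mult_right_mono) simp
  also have "\<dots> = m_perimeter m \<nu> E"
    using False \<open>emeasure \<nu> E \<noteq> \<top>\<close> by (simp add: ennreal_divide_times ennreal_divide_self less_top)
  finally show ?thesis .
qed simp

theorem corollary6p9:
  fixes m :: "'a \<Rightarrow> 'a measure" and \<nu> :: "'a measure" and \<Omega> :: "'a set"
  assumes "reversible_random_walk_space m \<nu>"
    and "\<Omega> \<in> sets \<nu>"
    and "m_connected m \<nu> \<Omega>"
    and "0 < emeasure \<nu> \<Omega>"
    and "emeasure \<nu> \<Omega> < emeasure \<nu> (m_closure m \<nu> \<Omega>)"
    and "emeasure \<nu> (m_closure m \<nu> \<Omega>) < \<infinity>"
    and "poincare_2 m \<nu> \<Omega>"
  shows "(emeasure \<nu> \<Omega>)\<^sup>2 / m_perimeter m \<nu> \<Omega> \<le> ennreal (m_torsional_rigidity m \<nu> \<Omega>) \<and>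
    (m_calibrable m \<nu> \<Omega> \<longrightarrow>
       ennreal (m_torsional_rigidity m \<nu> \<Omega>) \<le>
         1 / 2 * ((emeasure \<nu> \<Omega>)\<^sup>2 * emeasure \<nu> (m_closure m \<nu> \<Omega>) / (m_perimeter m \<nu> \<Omega>)\<^sup>2))"
proof -
  have "space \<nu> \<noteq> {}"
    using assms(2,4) sets.sets_into_space[OF assms(2)] by auto
  then interpret reversible_walk \<nu> m
    using assms(1)
    by (auto simp: reversible_walk_def reversible_walk_axioms_def reversible_random_walk_space_def random_walk_def)
  let ?C = "m_closure m \<nu> \<Omega>"
  have fin: "emeasure \<nu> \<Omega> < \<infinity>" using assms(5,6) by (rule less_trans)
  define V where "V = measure \<nu> \<Omega>"
  have V: "emeasure \<nu> \<Omega> = ennreal V" "0 < V"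
    using fin assms(4) by (auto simp: V_def emeasure_eq_ennreal_measure zero_less_measure_iff)
  have CV: "emeasure \<nu> ?C = ennreal (measure \<nu> ?C)"
    using assms(6) by (simp add: emeasure_eq_ennreal_measure)
  note ind = square_integrable_indicator[OF assms(2) fin]
  define p where "p = dirichlet (indicator \<Omega>) (indicator \<Omega>) / 2"
  have P: "m_perimeter m \<nu> \<Omega> = ennreal p"
    unfolding p_def by (rule dirichlet_indicator[OF assms(2) fin])
  obtain c where c: "0 < c" "\<And>u. square_integrable u \<Longrightarrow> (\<And>x. x \<notin> \<Omega> \<Longrightarrow> u x = 0) \<Longrightarrow>
      c * (\<integral>x. (u x)\<^sup>2 \<partial>\<nu>) \<le> dirichlet u u"
    using poincare_dirichlet[OF assms(2,7)] by blast
  \<comment> \<open>The Poincare inequality for the indicator of \<open>\<Omega>\<close> reads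
    \<open>c * V \<le> 2 * p\<close>, so the perimeter is positive and may be divided by.\<close>
  have "(\<lambda>x. (indicator \<Omega> x :: real)\<^sup>2) = indicator \<Omega>" by (auto simp: indicator_def)
  then have "c * V \<le> 2 * p"
    using c(2)[OF ind] assms(2) by (simp add: p_def V_def)
  then have p: "0 < p" using mult_pos_pos[OF c(1) V(2)] by linarith
  define f where "f = m_stress_function m \<nu> \<Omega>"
  \<comment> \<open>The choice operator returns a stress function because one exists; the bounds
    below hold for any representative.\<close>
  have f: "is_m_stress_function m \<nu> \<Omega> f"
    unfolding f_def m_stress_function_def
    by (rule someI_ex[OF stress_function_exists[OF assms(2) fin assms(7)]])
  then have L2: "L2_on \<nu> ?C f" and f0: "AE x in \<nu>. x \<in> m_boundary m \<nu> \<Omega> \<longrightarrow> f x = 0"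
    and eq: "AE x in \<nu>. x \<in> \<Omega> \<longrightarrow> - (LINT y:?C|m x. f y - f x) = 1"
    by (auto simp: is_m_stress_function_def)
  define u where "u x = indicator \<Omega> x * f x" for x
  have u: "square_integrable u"
    unfolding u_def by (rule L2_on_closure_restrict[OF assms(2) L2])
  have u0: "u x = 0" if "x \<notin> \<Omega>" for x using that by (simp add: u_def)
  have lap: "AE x in \<nu>. x \<in> \<Omega> \<longrightarrow> laplacian u x = 1"
    using set_integral_closure_eq_laplacian[OF assms(2) L2 f0] eq
    unfolding u_def[abs_def] by eventually_elim simp
  have T: "m_torsional_rigidity m \<nu> \<Omega> = (\<integral>x. u x \<partial>\<nu>)"
    by (simp add: m_torsional_rigidity_def set_lebesgue_integral_def u_def f_def)
  have "V\<^sup>2 / p \<le> (\<integral>x. u x \<partial>\<nu>)"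
    unfolding V_def by (rule torsion_lower_bound[OF assms(2) fin u u0 lap p_def p])
  then have lower: "(emeasure \<nu> \<Omega>)\<^sup>2 / m_perimeter m \<nu> \<Omega> \<le> ennreal (m_torsional_rigidity m \<nu> \<Omega>)"
    using p V by (simp add: T P ennreal_power divide_ennreal ennreal_leI)
  have "ennreal (m_torsional_rigidity m \<nu> \<Omega>) \<le>
      1 / 2 * ((emeasure \<nu> \<Omega>)\<^sup>2 * emeasure \<nu> ?C / (m_perimeter m \<nu> \<Omega>)\<^sup>2)" if cal: "m_calibrable m \<nu> \<Omega>"
  proof -
    \<comment> \<open>By calibrability the Cheeger constant is \<open>p / V\<close>, which plays the
      role of \<open>h\<close>.\<close>
    have "(\<integral>x. u x \<partial>\<nu>) \<le> measure \<nu> ?C / (2 * (p / V)\<^sup>2)"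
    proof (rule torsion_upper_bound[OF assms(2,6) u u0 lap])
      show "0 < p / V" using p V by simp
      show "ennreal (p / V) * emeasure \<nu> E \<le> m_perimeter m \<nu> E" if "E \<in> sets \<nu>" "E \<subseteq> \<Omega>" for E
        using m_calibrable_isoperimetric[OF cal that assms(2) fin] p V
        by (simp add: P divide_ennreal)
    qed
    also have "\<dots> = 1 / 2 * (V\<^sup>2 * measure \<nu> ?C / p\<^sup>2)"
      using p V by (simp add: field_simps power2_eq_square)
    finally have "ennreal (\<integral>x. u x \<partial>\<nu>) \<le> ennreal (1 / 2 * (V\<^sup>2 * measure \<nu> ?C / p\<^sup>2))"
      by (rule ennreal_leI)
    also have "\<dots> = ennreal (1 / 2) * ennreal (V\<^sup>2 * measure \<nu> ?C / p\<^sup>2)"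
      by (rule ennreal_mult') simp
    also have "ennreal (V\<^sup>2 * measure \<nu> ?C / p\<^sup>2) = ennreal (V\<^sup>2 * measure \<nu> ?C) / ennreal (p\<^sup>2)"
      using p by (intro divide_ennreal[symmetric]) auto
    also have "ennreal (1 / 2) = 1 / 2"
      using divide_ennreal[of 1 2] by simp
    finally show ?thesis
      using p V by (simp add: T P CV ennreal_power ennreal_mult)
  qed
  with lower show ?thesis by blast
qed

end
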